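(* Let $\gamma_t=(p_t,\tau_t^2,\sigma_t^2,\delta_{0t},\delta_{At})$, $t=1,2,\dots$, be a sequence of parameter vectors such that, with $u=\tau^2/\sigma^2$, $f=(1-p)/p$, $\delta=\delta_0/\delta_A$ and $v=uf^2\delta^2$ (index $t$ suppressed), one has as $t\to\infty$: $p\to 0$, $u\to\infty$, $v\to\infty$ and $\frac{\log v}{u}\to C\in(0,\infty)$. Let $\alpha=\alpha_t\in(0,1-p_t)$, let $c_{\mathrm{GW}}$ be the solution of $$\frac{1-\Phi(c_{\mathrm{GW}})}{(1-p)(1-\Phi(c_{\mathrm{GW}}))+p\left(1-\Phi\left(\frac{c_{\mathrm{GW}}}{\sqrt{u+1}}\right)\right)}=\alpha,$$ and let $c_B$ be the solution of $$\frac{(1-p)(1-\Phi(c_B))}{(1-p)(1-\Phi(c_B))+p\left(1-\Phi\left(\frac{c_B}{\sqrt{u+1}}\right)\right)}=\alpha .$$ Then the rule rejecting $H_{0i}$ iff $X_i^2/\sigma^2\ge c_{\mathrm{GW}}^2$ is ABOS if and only if the rule rejecting $H_{0i}$ iff $X_i^2/\sigma^2\ge c_B^2$ (the rule with BFDR equal to $\alpha$) is ABOS. In this case $$c_{\mathrm{GW}}^2=c_B^2+o_t .$$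
   Context: Model. Given a number of tests $m\ge 1$ and parameters $p\in(0,1)$, $\sigma^2>0$, $\tau^2>0$, let $(\nu_i,X_i)$, $i=1,\dots,m$, be i.i.d. with $P(\nu_i=1)=p=1-P(\nu_i=0)$, $X_i\mid\nu_i=0\sim N(0,\sigma^2)$ and $X_i\mid\nu_i=1\sim N(0,\sigma^2+\tau^2)$. Only the $X_i$ are observed. The null hypothesis $H_{0i}$ is the event $\nu_i=0$, the alternative $H_{Ai}$ is $\nu_i=1$. A type I error (rejecting a true $H_{0i}$) costs $\delta_0>0$, a type II error (accepting $H_{0i}$ when $H_{Ai}$ holds) costs $\delta_A>0$, and the total loss is the sum over the $m$ tests. The Bayes risk of a multiple testing rule is $R=\delta_0E(V)+\delta_AE(T)$, where $V$ is the number of false rejections and $T$ the number of false acceptances; for a rule applying one fixed threshold in all tests, $R=m((1-p)t_1\delta_0+p\,t_2\delta_A)$ with $t_1,t_2$ the probabilities of type I and type II errors in a single test. Bayes oracle: the rule minimizing $R$; it rejects $H_{0i}$ iff $X_i^2/\sigma^2\ge(1+\frac1u)\left(\log v+\log(1+\frac1u)\right)$, where $u=\tau^2/\sigma^2$, $f=(1-p)/p$, $\delta=\delta_0/\delta_A$, $v=uf^2\delta^2$. Its Bayes risk is denoted $R_{\mathrm{opt}}$. ABOS (asymptotically Bayes optimal under sparsity): a rule with risk $R$ is ABOS for the sequence $\gamma_t$ if $R/R_{\mathrm{opt}}\to1$ as $t\to\infty$. The number of tests $m=m_t$ may vary with $t$. BFDR (Bayesian False Discovery Rate) of a fixed threshold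 rule is $P(H_{0i}\text{ true}\mid H_{0i}\text{ rejected})=\frac{(1-p)t_1}{(1-p)t_1+p(1-t_2)}$. $\Phi$ is the standard normal cumulative distribution function; $o_t$ denotes a term tending to $0$ as $t\to\infty$. *)

theory Defs
  imports "HOL-Probability.Probability"
begin

text \<open>Parameter vector; \<open>tau2\<close> and \<open>sigma2\<close> are the variances \<open>\<tau>\<^sup>2\<close> and \<open>\<sigma>\<^sup>2\<close>.\<close>

record params =
  p :: real
  tau2 :: real
  sigma2 :: real
  delta0 :: real
  deltaA :: real

definition valid_params :: "params \<Rightarrow> bool" where
  "valid_params \<gamma> \<longleftrightarrow> 0 < p \<gamma> \<and> p \<gamma> < 1 \<and> 0 < tau2 \<gamma> \<and> 0 < sigma2 \<gamma>
     \<and> 0 < delta0 \<gamma> \<and> 0 < deltaA \<gamma>"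

definition par_u :: "params \<Rightarrow> real" where
  "par_u \<gamma> = tau2 \<gamma> / sigma2 \<gamma>"

definition par_f :: "params \<Rightarrow> real" where
  "par_f \<gamma> = (1 - p \<gamma>) / p \<gamma>"

definition par_delta :: "params \<Rightarrow> real" where
  "par_delta \<gamma> = delta0 \<gamma> / deltaA \<gamma>"

definition par_v :: "params \<Rightarrow> real" where
  "par_v \<gamma> = par_u \<gamma> * (par_f \<gamma>)\<^sup>2 * (par_delta \<gamma>)\<^sup>2"

definition std_normal_cdf :: "real \<Rightarrow> real" where
  "std_normal_cdf x = cdf std_normal_distribution x"

text \<open>
  Law of \<open>X\<close> given \<open>\<nu>\<close>; \<open>True\<close> encodes \<open>\<nu> = 1\<close> (alternative), \<open>False\<close> encodes \<open>\<nu> = 0\<close> (null).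
  The second argument of \<open>normal_density\<close> is a standard deviation.
\<close>

definition cond_law :: "params \<Rightarrow> bool \<Rightarrow> real measure" where
  "cond_law \<gamma> \<nu> = density lborel
     (normal_density 0 (sqrt (if \<nu> then sigma2 \<gamma> + tau2 \<gamma> else sigma2 \<gamma>)))"

text \<open>Joint law of one pair \<open>(\<nu>\<^sub>i, X\<^sub>i)\<close>, and of the \<open>m\<close> independent pairs, indexed by \<open>{1..m}\<close>.\<close>

definition test_law :: "params \<Rightarrow> (bool \<times> real) measure" where
  "test_law \<gamma> = measure_pmf (bernoulli_pmf (p \<gamma>)) \<bind>
     (\<lambda>\<nu>. distr (cond_law \<gamma> \<nu>) (count_space UNIV \<Otimes>\<^sub>M borel) (\<lambda>x. (\<nu>, x)))"

definition model :: "params \<Rightarrow> nat \<Rightarrow> (nat \<Rightarrow> bool \<times> real) measure" where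
  "model \<gamma> m = (\<Pi>\<^sub>M i\<in>{1..m}. test_law \<gamma>)"

text \<open>
  A multiple testing rule maps the observations \<open>x\<close> and a test index \<open>i\<close> to \<open>True\<close> iff the
  \<open>i\<close>-th null hypothesis is rejected.  It sees only the \<open>X\<^sub>i\<close>, not the \<open>\<nu>\<^sub>i\<close>, but the decision
  for test \<open>i\<close> may depend on all observations.
\<close>

type_synonym rule = "(nat \<Rightarrow> real) \<Rightarrow> nat \<Rightarrow> bool"

definition measurable_rule :: "nat \<Rightarrow> rule \<Rightarrow> bool" where
  "measurable_rule m r \<longleftrightarrow>
     (\<forall>i\<in>{1..m}. Measurable.pred (\<Pi>\<^sub>M j\<in>{1..m}. borel) (\<lambda>x. r x i))"

definition observed :: "nat \<Rightarrow> (nat \<Rightarrow> bool \<times> real) \<Rightarrow> nat \<Rightarrow> real" where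
  "observed m \<omega> = (\<lambda>i\<in>{1..m}. snd (\<omega> i))"

definition false_rejections :: "nat \<Rightarrow> rule \<Rightarrow> (nat \<Rightarrow> bool \<times> real) \<Rightarrow> nat" where
  "false_rejections m r \<omega> = card {i\<in>{1..m}. \<not> fst (\<omega> i) \<and> r (observed m \<omega>) i}"

definition false_acceptances :: "nat \<Rightarrow> rule \<Rightarrow> (nat \<Rightarrow> bool \<times> real) \<Rightarrow> nat" where
  "false_acceptances m r \<omega> = card {i\<in>{1..m}. fst (\<omega> i) \<and> \<not> r (observed m \<omega>) i}"

definition bayes_risk :: "params \<Rightarrow> nat \<Rightarrow> rule \<Rightarrow> real" where
  "bayes_risk \<gamma> m r =
     delta0 \<gamma> * (\<integral>\<omega>. real (false_rejections m r \<omega>) \<partial>model \<gamma> m)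
   + deltaA \<gamma> * (\<integral>\<omega>. real (false_acceptances m r \<omega>) \<partial>model \<gamma> m)"

text \<open>
  The Bayes oracle minimizes the Bayes risk over all rules, so its risk is the infimum below.
  The infimum is attained by rejecting the \<open>i\<close>-th null hypothesis iff
  \<open>x\<^sub>i\<^sup>2 / \<sigma>\<^sup>2 \<ge> (1 + 1/u) (ln v + ln (1 + 1/u))\<close>.
\<close>

definition optimal_risk :: "params \<Rightarrow> nat \<Rightarrow> real" where
  "optimal_risk \<gamma> m = (INF r\<in>{r. measurable_rule m r}. bayes_risk \<gamma> m r)"

definition threshold_rule :: "params \<Rightarrow> real \<Rightarrow> rule" where
  "threshold_rule \<gamma> c x i \<longleftrightarrow> (x i)\<^sup>2 / sigma2 \<gamma> \<ge> c\<^sup>2"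

definition ABOS :: "(nat \<Rightarrow> params) \<Rightarrow> (nat \<Rightarrow> nat) \<Rightarrow> (nat \<Rightarrow> rule) \<Rightarrow> bool" where
  "ABOS \<gamma> m r \<longleftrightarrow>
     (\<lambda>t. bayes_risk (\<gamma> t) (m t) (r t) / optimal_risk (\<gamma> t) (m t)) \<longlonglongrightarrow> 1"

definition solves_GW :: "params \<Rightarrow> real \<Rightarrow> real \<Rightarrow> bool" where
  "solves_GW \<gamma> \<alpha> c \<longleftrightarrow>
     (1 - std_normal_cdf c) /
     ((1 - p \<gamma>) * (1 - std_normal_cdf c)
        + p \<gamma> * (1 - std_normal_cdf (c / sqrt (par_u \<gamma> + 1)))) = \<alpha>"

definition solves_B :: "params \<Rightarrow> real \<Rightarrow> real \<Rightarrow> bool" where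
  "solves_B \<gamma> \<alpha> c \<longleftrightarrow>
     (1 - p \<gamma>) * (1 - std_normal_cdf c) /
     ((1 - p \<gamma>) * (1 - std_normal_cdf c)
        + p \<gamma> * (1 - std_normal_cdf (c / sqrt (par_u \<gamma> + 1)))) = \<alpha>"

end

theory Submission
  imports Defs "HOL-Real_Asymp.Real_Asymp"
begin

text \<open>
  Write \<open>Q = 1 - \<Phi>\<close>, \<open>a = sqrt (u + 1)\<close> and \<open>r(c) = Q(c) / Q(c / a)\<close>. Divided by \<open>m p \<delta>\<^sub>A\<close>, the risk of the
  rule with threshold \<open>c > 0\<close> is \<open>2 f \<delta> Q(c) + (1 - 2 Q(c / a))\<close>: a type I part and a type II part.
  An arbitrary rule, whatever use it makes of the other observations, has at least the
  type II part of the oracle threshold \<open>k\<close>, because on \<open>x\<^sup>2 / \<sigma>\<^sup>2 \<le> k\<^sup>2\<close> rejecting costs at least as much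
  as accepting (\<open>bayes_risk_lower_bound\<close>). Since \<open>k / a \<longlonglongrightarrow> sqrt C\<close> and the type I part of \<open>k\<close>
  vanishes, the optimal risk divided by \<open>m p \<delta>\<^sub>A\<close> tends to \<open>D = 1 - 2 Q(sqrt C) > 0\<close>
  (\<open>optimal_risk_tendsto\<close>).

  A threshold sequence \<open>c > 0\<close> is therefore ABOS iff its scaled risk tends to \<open>D\<close>, and this
  happens iff \<open>c / a \<longlonglongrightarrow> sqrt C\<close> and \<open>f \<delta> Q(c) \<longlonglongrightarrow> 0\<close> (\<open>ABOS_iff\<close>). Indeed, \<open>c / a\<close> cannot stay above
  \<open>sqrt C\<close>, as the type II part alone would exceed \<open>D\<close>; and it cannot stay below, as the
  type I part would be unbounded: \<open>f \<delta> = sqrt (v / u) = exp (C u / 2 + o(u))\<close>, whereas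
  \<open>Q(s a) = exp (- s\<^sup>2 u / 2 + o(u))\<close> for \<open>0 < s < sqrt C\<close>.

  The two equations for the thresholds say that \<open>r(c\<^sub>G\<^sub>W) = \<alpha> p / (1 - \<alpha> (1 - p))\<close> and
  \<open>r(c\<^sub>B) = \<alpha> p / ((1 - p) (1 - \<alpha>))\<close>, whence \<open>r(c\<^sub>G\<^sub>W) / r(c\<^sub>B) = (1 - p) (1 - r(c\<^sub>G\<^sub>W))\<close>. If either rule is
  ABOS, then \<open>r(c\<^sub>G\<^sub>W) \<longlonglongrightarrow> 0\<close>, so this quotient tends to 1. The bounds \<open>x \<le> \<phi>(x) / Q(x) \<le> x + 1\<close> on the
  hazard rate, valid for \<open>x > 0\<close> with \<open>\<phi>\<close> the standard normal density, show that \<open>ln r\<close> decreases at least about as fast as \<open>c\<^sup>2 / 2\<close>, so that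
  \<open>c\<^sub>G\<^sub>W\<^sup>2 - c\<^sub>B\<^sup>2 \<longlonglongrightarrow> 0\<close>. Both conditions of \<open>ABOS_iff\<close> then pass from one threshold to the other
  (\<open>transfer_threshold\<close>, which is symmetric in the roles of the two).
\<close>

section \<open>Tails of the standard normal distribution\<close>

text \<open>The upper tail probability \<open>Q = 1 - \<Phi>\<close>.\<close>

definition normal_tail :: "real \<Rightarrow> real" where
  "normal_tail x = 1 - std_normal_cdf x"

lemma real_distribution_std_normal: "real_distribution std_normal_distribution"
  using real_dist_normal_dist by simp

lemma normal_tail_diff:
  assumes "a \<le> b"
  shows "normal_tail a - normal_tail b = integral {a..b} std_normal_density"
proof -
  interpret real_distribution std_normal_distribution by (rule real_distribution_std_normal)
  have int: "integrable lborel std_normal_density"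
    by simp
  have "normal_tail a - normal_tail b = measure std_normal_distribution {a<..b}"
  proof (cases "a = b")
    case False
    then show ?thesis
      using cdf_diff_eq[of a b] assms by (simp add: normal_tail_def std_normal_cdf_def)
  qed simp
  also have "\<dots> = (\<integral>x. std_normal_density x * indicator {a<..b} x \<partial>lborel)"
    unfolding measure_def
    by (subst emeasure_density)
       (simp_all add: integral_eq_nn_integral ennreal_mult' ennreal_indicator)
  also have "\<dots> = (LINT x:{a..b}|lborel. std_normal_density x)"
    unfolding set_lebesgue_integral_def
    by (rule integral_cong_AE) (use AE_lborel_singleton[of a] in \<open>auto elim!: eventually_mono simp: indicator_def\<close>)
  also have "\<dots> = integral {a..b} std_normal_density"
    by (rule set_borel_integral_eq_integral)
       (use int in \<open>simp add: set_integrable_def integrable_mult_indicator[of _ lborel std_normal_density, simplified]\<close>)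
  finally show ?thesis .
qed

lemma normal_tail_has_derivative:
  "(normal_tail has_real_derivative - std_normal_density x) (at x)"
proof -
  have "continuous_on {x - 1..x + 1} std_normal_density"
    unfolding normal_density_def by (intro continuous_intros) auto
  then have "((\<lambda>y. integral {x - 1..y} std_normal_density) has_real_derivative std_normal_density x)
      (at x within {x - 1..x + 1})"
    by (rule integral_has_real_derivative) auto
  then have "((\<lambda>y. integral {x - 1..y} std_normal_density) has_real_derivative std_normal_density x) (at x)"
    by (simp add: at_within_Icc_at)
  then have "((\<lambda>y. normal_tail (x - 1) - integral {x - 1..y} std_normal_density)
      has_real_derivative - std_normal_density x) (at x)"
    by (auto intro!: derivative_eq_intros)
  moreover have "\<forall>\<^sub>F y in nhds x. normal_tail (x - 1) - integral {x - 1..y} std_normal_density = normal_tail y"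
  proof -
    have "\<forall>\<^sub>F y in nhds x. y \<in> {x - 1<..}"
      by (rule eventually_nhds_in_open) auto
    then show ?thesis
      by eventually_elim (use normal_tail_diff[of "x - 1"] in \<open>force simp: algebra_simps\<close>)
  qed
  ultimately show ?thesis
    by (subst DERIV_cong_ev[OF refl _ refl, symmetric]) auto
qed

lemma isCont_normal_tail: "isCont normal_tail x"
  using normal_tail_has_derivative DERIV_isCont by blast

lemma normal_tail_at_top: "(normal_tail \<longlongrightarrow> 0) at_top"
proof -
  interpret real_distribution std_normal_distribution by (rule real_distribution_std_normal)
  show ?thesis
    using tendsto_diff[OF tendsto_const[of 1] cdf_lim_at_top_prob]
    by (simp add: normal_tail_def[abs_def] std_normal_cdf_def[abs_def])
qed

lemma normal_tail_antimono: "x \<le> y \<Longrightarrow> normal_tail y \<le> normal_tail x"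
proof -
  interpret real_distribution std_normal_distribution by (rule real_distribution_std_normal)
  show "x \<le> y \<Longrightarrow> normal_tail y \<le> normal_tail x"
    using cdf_nondecreasing by (simp add: normal_tail_def std_normal_cdf_def)
qed

lemma std_normal_density_has_derivative:
  "(std_normal_density has_real_derivative - x * std_normal_density x) (at x)"
  unfolding std_normal_density_def
  by (auto intro!: derivative_eq_intros simp: field_simps)

text \<open>Chain-rule versions, for the automatic computation of derivatives.\<close>

declare normal_tail_has_derivative[THEN DERIV_chain2, derivative_intros]
  std_normal_density_has_derivative[THEN DERIV_chain2, derivative_intros]

lemma antimono_tendsto_0_nonneg:
  fixes F :: "real \<Rightarrow> real"
  assumes der: "\<And>x. a \<le> x \<Longrightarrow> (F has_real_derivative F' x) (at x)"
    and neg: "\<And>x. a \<le> x \<Longrightarrow> F' x \<le> 0"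
    and lim: "(F \<longlongrightarrow> 0) at_top"
  shows "0 \<le> F a"
proof (rule tendsto_upperbound[OF lim])
  have "F x \<le> F a" if "a \<le> x" for x
    using that by (rule DERIV_nonpos_imp_nonincreasing) (use der neg in blast)
  then show "\<forall>\<^sub>F x in at_top. F x \<le> F a"
    by (auto intro: eventually_at_top_linorderI)
qed simp

text \<open>
  Together with \<open>normal_tail_le\<close> this is the two-sided bound \<open>x \<le> \<phi>(x) / Q(x) \<le> x + 1\<close> on the hazard rate,
  where \<open>\<phi>\<close> is the standard normal density and \<open>x > 0\<close>.
  Each difference tends to 0 at infinity and decreases.
\<close>

lemma normal_tail_ge:
  assumes "0 \<le> x"
  shows "std_normal_density x / (x + 1) \<le> normal_tail x"
proof -
  have "0 \<le> normal_tail x - std_normal_density x / (x + 1)"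
  proof (rule antimono_tendsto_0_nonneg[where a = x and F = "\<lambda>x. normal_tail x - std_normal_density x / (x + 1)"])
    fix y assume y: "x \<le> y"
    show "((\<lambda>x. normal_tail x - std_normal_density x / (x + 1)) has_real_derivative
       - (y * std_normal_density y / (y + 1)\<^sup>2)) (at y)"
    proof -
      have "- std_normal_density y - (- y * std_normal_density y * (y + 1) - std_normal_density y)
          / ((y + 1) * (y + 1)) = - (y * std_normal_density y / (y + 1)\<^sup>2)"
        using y assms by (simp add: divide_simps power2_eq_square add_eq_0_iff) (simp add: algebra_simps)
      then show ?thesis
        using y assms by (auto intro!: derivative_eq_intros)
    qed
    show "- (y * std_normal_density y / (y + 1)\<^sup>2) \<le> 0"
      using y assms by simp
  next
    have "((\<lambda>x. std_normal_density x / (x + 1)) \<longlongrightarrow> 0) at_top"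
      unfolding std_normal_density_def by real_asymp
    from tendsto_diff[OF normal_tail_at_top this]
    show "((\<lambda>x. normal_tail x - std_normal_density x / (x + 1)) \<longlongrightarrow> 0) at_top" by simp
  qed
  then show ?thesis by simp
qed

lemma normal_tail_le:
  assumes "0 < x"
  shows "normal_tail x \<le> std_normal_density x / x"
proof -
  have "0 \<le> std_normal_density x / x - normal_tail x"
  proof (rule antimono_tendsto_0_nonneg[where a = x and F = "\<lambda>x. std_normal_density x / x - normal_tail x"])
    fix y assume y: "x \<le> y"
    show "((\<lambda>x. std_normal_density x / x - normal_tail x) has_real_derivative
       - (std_normal_density y / y\<^sup>2)) (at y)"
      using y assms
      by (auto intro!: derivative_eq_intros simp: power2_eq_square field_simps)
    show "- (std_normal_density y / y\<^sup>2) \<le> 0"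
      by simp
  next
    have "((\<lambda>x. std_normal_density x / x) \<longlongrightarrow> 0) at_top"
      unfolding std_normal_density_def by real_asymp
    from tendsto_diff[OF this normal_tail_at_top]
    show "((\<lambda>x. std_normal_density x / x - normal_tail x) \<longlongrightarrow> 0) at_top" by simp
  qed
  then show ?thesis by simp
qed

lemma normal_tail_pos: "0 < normal_tail x"
proof -
  have "0 < std_normal_density (max x 0) / (max x 0 + 1)"
    by (intro divide_pos_pos normal_density_pos) auto
  also have "\<dots> \<le> normal_tail (max x 0)"
    by (rule normal_tail_ge) simp
  also have "\<dots> \<le> normal_tail x"
    by (rule normal_tail_antimono) simp
  finally show ?thesis .
qed

lemma normal_tail_less:
  assumes "x < y"
  shows "normal_tail y < normal_tail x"
proof (rule DERIV_neg_imp_decreasing[OF assms])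
  fix z
  show "\<exists>d. (normal_tail has_real_derivative d) (at z) \<and> d < 0"
    using normal_tail_has_derivative[of z] normal_density_pos[of 1 0 z]
    by (intro exI[of _ "- std_normal_density z"]) simp
qed

text \<open>
  The hazard rate is minus the derivative of \<open>ln Q\<close>, so its bounds integrate to bounds on
  differences of \<open>ln Q\<close>.
\<close>

lemma ln_normal_tail_diff_ge:
  assumes "0 < x" "x \<le> y"
  shows "(y\<^sup>2 - x\<^sup>2) / 2 \<le> ln (normal_tail x) - ln (normal_tail y)"
proof -
  have "- ln (normal_tail x) - x\<^sup>2 / 2 \<le> - ln (normal_tail y) - y\<^sup>2 / 2"
  proof (rule DERIV_nonneg_imp_nondecreasing[OF \<open>x \<le> y\<close>])
    fix z assume z: "x \<le> z" "z \<le> y"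
    have "((\<lambda>x. - ln (normal_tail x) - x\<^sup>2 / 2) has_real_derivative
        std_normal_density z / normal_tail z - z) (at z)"
      by (auto intro!: derivative_eq_intros simp: normal_tail_pos)
    moreover have "0 \<le> std_normal_density z / normal_tail z - z"
      using normal_tail_le[of z] normal_tail_pos[of z] z assms by (simp add: field_simps)
    ultimately show "\<exists>d. ((\<lambda>x. - ln (normal_tail x) - x\<^sup>2 / 2) has_real_derivative d) (at z) \<and> 0 \<le> d"
      by blast
  qed
  then show ?thesis by (simp add: field_simps)
qed

lemma ln_normal_tail_diff_le:
  assumes "0 \<le> x" "x \<le> y"
  shows "ln (normal_tail x) - ln (normal_tail y) \<le> (y\<^sup>2 - x\<^sup>2) / 2 + (y - x)"
proof -
  have "x\<^sup>2 / 2 + x + ln (normal_tail x) \<le> y\<^sup>2 / 2 + y + ln (normal_tail y)"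
  proof (rule DERIV_nonneg_imp_nondecreasing[OF \<open>x \<le> y\<close>])
    fix z assume z: "x \<le> z" "z \<le> y"
    have "((\<lambda>x. x\<^sup>2 / 2 + x + ln (normal_tail x)) has_real_derivative
        z + 1 - std_normal_density z / normal_tail z) (at z)"
      by (auto intro!: derivative_eq_intros simp: normal_tail_pos)
    moreover have "0 \<le> z + 1 - std_normal_density z / normal_tail z"
      using normal_tail_ge[of z] normal_tail_pos[of z] z assms by (simp add: field_simps)
    ultimately show "\<exists>d. ((\<lambda>x. x\<^sup>2 / 2 + x + ln (normal_tail x)) has_real_derivative d) (at z) \<and> 0 \<le> d"
      by blast
  qed
  then show ?thesis by (simp add: field_simps)
qed

lemma measure_std_normal_atLeast: "measure std_normal_distribution {y..} = normal_tail y"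
proof -
  interpret real_distribution std_normal_distribution by (rule real_distribution_std_normal)
  have "isCont (cdf std_normal_distribution) y"
    using continuous_diff[OF continuous_const[of _ 1] isCont_normal_tail[of y]]
    by (simp add: normal_tail_def[abs_def] std_normal_cdf_def)
  then have 0: "prob {y} = 0"
    by (simp add: isCont_cdf)
  have "prob {y..} = prob ({y} \<union> (UNIV - {..y}))"
    by (rule arg_cong[where f = prob]) auto
  also have "\<dots> = prob {y} + prob (space std_normal_distribution - {..y})"
    by (subst finite_measure_Union) auto
  also have "\<dots> = normal_tail y"
    by (subst prob_compl) (use 0 in \<open>auto simp: normal_tail_def std_normal_cdf_def cdf_def\<close>)
  finally show ?thesis .
qed

text \<open>A negative factor is allowed, so that \<open>\<alpha> = -1\<close> gives the symmetry of the normal law.\<close>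

lemma density_normal_eq_distr:
  assumes "\<alpha> \<noteq> 0"
  shows "density lborel (normal_density 0 \<bar>\<alpha>\<bar>) = distr std_normal_distribution borel (\<lambda>x. \<alpha> * x)"
proof -
  interpret real_distribution std_normal_distribution by (rule real_distribution_std_normal)
  have "distributed std_normal_distribution lborel (\<lambda>x. x) std_normal_density"
    by (simp add: distributed_def distr_id2 sets_eq_imp_space_eq)
  from normal_density_affine[OF this _ assms, of 0]
  have "distr std_normal_distribution lborel (\<lambda>x. \<alpha> * x) = density lborel (normal_density 0 \<bar>\<alpha>\<bar>)"
    by (auto simp: distributed_def)
  moreover have "distr std_normal_distribution lborel (\<lambda>x. \<alpha> * x) = distr std_normal_distribution borel (\<lambda>x. \<alpha> * x)"
    by (rule distr_cong) auto
  ultimately show ?thesis by simp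
qed

lemma measure_normal_abs_ge:
  assumes "0 < s" "0 < b"
  shows "measure (density lborel (normal_density 0 s)) {x. b \<le> \<bar>x\<bar>} = 2 * normal_tail (b / s)"
proof -
  interpret real_distribution std_normal_distribution by (rule real_distribution_std_normal)
  define y where "y = b / s"
  have "y > 0" using assms by (simp add: y_def)
  have "measure (density lborel (normal_density 0 s)) {x. b \<le> \<bar>x\<bar>}
      = prob ((\<lambda>x. s * x) -` {x. b \<le> \<bar>x\<bar>})"
    using density_normal_eq_distr[of s] assms by (simp add: measure_distr)
  also have "(\<lambda>x. s * x) -` {x. b \<le> \<bar>x\<bar>} = {y..} \<union> uminus -` {y..}"
    using assms by (auto simp: y_def abs_mult field_simps abs_if)
  also have "prob \<dots> = prob {y..} + prob (uminus -` {y..})"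
    using \<open>y > 0\<close> by (intro finite_measure_Union) (auto intro!: measurable_sets_borel[of uminus borel])
  also have "prob (uminus -` {y..}) = measure (distr std_normal_distribution borel uminus) {y..}"
    by (simp add: measure_distr)
  also have "distr std_normal_distribution borel uminus = std_normal_distribution"
    using density_normal_eq_distr[of "-1"] by simp
  finally show ?thesis
    by (simp add: measure_std_normal_atLeast y_def)
qed

section \<open>The law of the observations and the Bayes risk\<close>

lemma prob_space_cond_law: "prob_space (cond_law \<gamma> \<nu>)"
  if "valid_params \<gamma>"
  using that by (auto simp: cond_law_def valid_params_def intro!: prob_space_normal_density)

lemma sets_cond_law [simp, measurable_cong]: "sets (cond_law \<gamma> \<nu>) = sets borel"
  by (simp add: cond_law_def)

lemma test_kernel_measurable:
  assumes "valid_params \<gamma>"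
  shows "(\<lambda>\<nu>. distr (cond_law \<gamma> \<nu>) (count_space UNIV \<Otimes>\<^sub>M borel) (\<lambda>x. (\<nu>, x)))
    \<in> measurable (measure_pmf (bernoulli_pmf (p \<gamma>))) (subprob_algebra (count_space UNIV \<Otimes>\<^sub>M borel))"
proof -
  have "prob_space (distr (cond_law \<gamma> \<nu>) (count_space UNIV \<Otimes>\<^sub>M borel) (\<lambda>x. (\<nu>, x)))" for \<nu>
    by (rule prob_space.prob_space_distr[OF prob_space_cond_law[OF assms]]) measurable
  then show ?thesis
    by (auto simp: space_subprob_algebra intro: prob_space_imp_subprob_space)
qed

lemma prob_space_test_law:
  assumes "valid_params \<gamma>"
  shows "prob_space (test_law \<gamma>)"
  unfolding test_law_def
  by (rule measure_pmf.prob_space_bind[OF _ test_kernel_measurable[OF assms]])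
     (auto intro!: prob_space.prob_space_distr[OF prob_space_cond_law[OF assms]])

lemma sets_test_law:
  assumes "valid_params \<gamma>"
  shows "sets (test_law \<gamma>) = sets (count_space UNIV \<Otimes>\<^sub>M borel)"
  unfolding test_law_def
  by (rule sets_bind[OF sets_kernel[OF test_kernel_measurable[OF assms]]]) auto

lemma emeasure_test_law:
  assumes "valid_params \<gamma>" and S: "S \<in> sets borel"
  shows "emeasure (test_law \<gamma>) ({\<nu>} \<times> S)
    = ennreal (if \<nu> then p \<gamma> else 1 - p \<gamma>) * emeasure (cond_law \<gamma> \<nu>) S"
proof -
  have [measurable]: "{\<nu>} \<times> S \<in> sets (count_space UNIV \<Otimes>\<^sub>M borel)"
    using S by auto
  have *: "emeasure (distr (cond_law \<gamma> b) (count_space UNIV \<Otimes>\<^sub>M borel) (\<lambda>x. (b, x))) ({\<nu>} \<times> S)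
      = (if b = \<nu> then emeasure (cond_law \<gamma> \<nu>) S else 0)" for b
  proof -
    have "(\<lambda>x. (b, x)) -` ({\<nu>} \<times> S) \<inter> space (cond_law \<gamma> b) = (if b = \<nu> then S else {})"
      by (auto simp: cond_law_def)
    then show ?thesis
      by (subst emeasure_distr) auto
  qed
  have "emeasure (test_law \<gamma>) ({\<nu>} \<times> S) = (\<integral>\<^sup>+b. (if b = \<nu> then emeasure (cond_law \<gamma> \<nu>) S else 0)
      \<partial>measure_pmf (bernoulli_pmf (p \<gamma>)))"
    unfolding test_law_def
    by (subst emeasure_bind[OF _ test_kernel_measurable[OF assms(1)]]) (use S in \<open>auto simp: *\<close>)
  also have "\<dots> = ennreal (if \<nu> then p \<gamma> else 1 - p \<gamma>) * emeasure (cond_law \<gamma> \<nu>) S"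
    using assms(1) by (subst nn_integral_bernoulli_pmf) (auto simp: valid_params_def mult.commute)
  finally show ?thesis .
qed

lemma prob_space_model:
  assumes "valid_params \<gamma>"
  shows "prob_space (model \<gamma> m)"
  unfolding model_def by (rule prob_space_PiM) (rule prob_space_test_law[OF assms])

lemma measurable_observation:
  assumes "valid_params \<gamma>" "i \<in> {1..m}"
  shows "(\<lambda>\<omega>. fst (\<omega> i)) \<in> measurable (model \<gamma> m) (count_space UNIV)"
    and "(\<lambda>\<omega>. snd (\<omega> i)) \<in> measurable (model \<gamma> m) borel"
proof -
  have [measurable_cong]: "sets (test_law \<gamma>) = sets (count_space UNIV \<Otimes>\<^sub>M borel)"
    by (rule sets_test_law[OF assms(1)])
  show "(\<lambda>\<omega>. fst (\<omega> i)) \<in> measurable (model \<gamma> m) (count_space UNIV)"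
    "(\<lambda>\<omega>. snd (\<omega> i)) \<in> measurable (model \<gamma> m) borel"
    unfolding model_def using assms(2) by measurable
qed

lemma measurable_observed:
  assumes "valid_params \<gamma>"
  shows "observed m \<in> measurable (model \<gamma> m) (\<Pi>\<^sub>M i\<in>{1..m}. borel)"
  unfolding observed_def[abs_def]
  by (rule measurable_restrict) (rule measurable_observation(2)[OF assms])

lemma measurable_decision:
  assumes "valid_params \<gamma>" "measurable_rule m r" "i \<in> {1..m}"
  shows "Measurable.pred (model \<gamma> m) (\<lambda>\<omega>. r (observed m \<omega>) i)"
  using assms measurable_compose[OF measurable_observed[OF assms(1)]]
  unfolding measurable_rule_def by blast

text \<open>Linearity of expectation for the number of events that occur.\<close>

lemma expectation_card:
  assumes "prob_space M" "finite I" "\<And>i. i \<in> I \<Longrightarrow> Measurable.pred M (P i)"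
  shows "(\<integral>\<omega>. real (card {i \<in> I. P i \<omega>}) \<partial>M) = (\<Sum>i\<in>I. measure M {\<omega> \<in> space M. P i \<omega>})"
proof -
  interpret prob_space M by fact
  have "(\<integral>\<omega>. real (card {i \<in> I. P i \<omega>}) \<partial>M)
      = (\<integral>\<omega>. (\<Sum>i\<in>I. indicator {\<omega> \<in> space M. P i \<omega>} \<omega>) \<partial>M)"
  proof (rule Bochner_Integration.integral_cong[OF refl])
    fix \<omega> assume "\<omega> \<in> space M"
    then have "(\<Sum>i\<in>I. indicat_real {\<omega> \<in> space M. P i \<omega>} \<omega>) = (\<Sum>i\<in>I. of_bool (P i \<omega>))"
      by (intro sum.cong) auto
    then show "real (card {i \<in> I. P i \<omega>}) = (\<Sum>i\<in>I. indicat_real {\<omega> \<in> space M. P i \<omega>} \<omega>)"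
      using \<open>finite I\<close> by (simp add: Int_def)
  qed
  also have "\<dots> = (\<Sum>i\<in>I. measure M {\<omega> \<in> space M. P i \<omega>})"
    using assms(3) by (subst Bochner_Integration.integral_sum) (auto simp: emeasure_eq_measure)
  finally show ?thesis .
qed

lemma bayes_risk_eq_sum:
  assumes "valid_params \<gamma>" "measurable_rule m r"
  shows "bayes_risk \<gamma> m r = (\<Sum>i\<in>{1..m}.
      delta0 \<gamma> * measure (model \<gamma> m) {\<omega> \<in> space (model \<gamma> m). \<not> fst (\<omega> i) \<and> r (observed m \<omega>) i}
    + deltaA \<gamma> * measure (model \<gamma> m) {\<omega> \<in> space (model \<gamma> m). fst (\<omega> i) \<and> \<not> r (observed m \<omega>) i})"
proof -
  note [measurable] = measurable_observation[OF assms(1)] measurable_decision[OF assms]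
  show ?thesis
    unfolding bayes_risk_def false_rejections_def false_acceptances_def
    by (subst (1 2) expectation_card[OF prob_space_model[OF assms(1)]])
       (simp_all add: sum.distrib sum_distrib_left)
qed

lemma prob_single_test:
  assumes "valid_params \<gamma>" "i \<in> {1..m}" "S \<in> sets borel"
  shows "measure (model \<gamma> m) {\<omega> \<in> space (model \<gamma> m). fst (\<omega> i) = \<nu> \<and> snd (\<omega> i) \<in> S}
    = (if \<nu> then p \<gamma> else 1 - p \<gamma>) * measure (cond_law \<gamma> \<nu>) S"
proof -
  have "measure (test_law \<gamma>) ({\<nu>} \<times> S)
      = measure (distr (model \<gamma> m) (test_law \<gamma>) (\<lambda>\<omega>. \<omega> i)) ({\<nu>} \<times> S)"
    unfolding model_def using assms
    by (subst distr_PiM_component) (auto intro: prob_space_test_law)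
  also have "\<dots> = measure (model \<gamma> m) {\<omega> \<in> space (model \<gamma> m). fst (\<omega> i) = \<nu> \<and> snd (\<omega> i) \<in> S}"
    using assms
    by (subst measure_distr)
       (auto simp: sets_test_law model_def mem_Times_iff intro!: arg_cong[where f = "measure _"])
  moreover have "measure (test_law \<gamma>) ({\<nu>} \<times> S)
      = (if \<nu> then p \<gamma> else 1 - p \<gamma>) * measure (cond_law \<gamma> \<nu>) S"
    using assms by (auto simp: measure_def emeasure_test_law enn2real_mult valid_params_def)
  ultimately show ?thesis by simp
qed

text \<open>
  The risk of the rule with threshold \<open>c > 0\<close> divided by \<open>m p \<delta>\<^sub>A\<close> (see \<open>bayes_risk_threshold_rule\<close>);
  it does not depend on \<open>m\<close>. The first summand comes from the type I errors, the second is the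
  probability of a type II error.
\<close>

definition scaled_risk :: "params \<Rightarrow> real \<Rightarrow> real" where
  "scaled_risk \<gamma> c = 2 * par_f \<gamma> * par_delta \<gamma> * normal_tail c
     + (1 - 2 * normal_tail (c / sqrt (par_u \<gamma> + 1)))"

lemma measurable_threshold_rule: "measurable_rule m (threshold_rule \<gamma> c)"
  unfolding measurable_rule_def threshold_rule_def by measurable

lemma threshold_iff:
  assumes "0 < s" "0 < c"
  shows "x\<^sup>2 / s \<ge> c\<^sup>2 \<longleftrightarrow> c * sqrt s \<le> \<bar>x::real\<bar>"
proof -
  have "x\<^sup>2 / s \<ge> c\<^sup>2 \<longleftrightarrow> (c * sqrt s)\<^sup>2 \<le> \<bar>x\<bar>\<^sup>2"
    using assms by (simp add: power_mult_distrib pos_le_divide_eq)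
  also have "\<dots> \<longleftrightarrow> c * sqrt s \<le> \<bar>x\<bar>"
    using assms by (subst abs_le_square_iff[symmetric]) (simp add: abs_mult)
  finally show ?thesis .
qed

lemma cond_law_abs_ge:
  assumes "valid_params \<gamma>" "0 < c"
  shows "measure (cond_law \<gamma> \<nu>) {x. c * sqrt (sigma2 \<gamma>) \<le> \<bar>x\<bar>}
    = 2 * normal_tail (if \<nu> then c / sqrt (par_u \<gamma> + 1) else c)"
proof -
  have "c * sqrt (sigma2 \<gamma>) / sqrt (sigma2 \<gamma> + tau2 \<gamma>) = c / sqrt (par_u \<gamma> + 1)"
  proof -
    have "par_u \<gamma> + 1 = (sigma2 \<gamma> + tau2 \<gamma>) / sigma2 \<gamma>"
      using assms by (simp add: par_u_def valid_params_def field_simps)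
    then show ?thesis
      by (simp add: real_sqrt_divide)
  qed
  then show ?thesis
    unfolding cond_law_def using assms
    by (subst measure_normal_abs_ge) (auto simp: valid_params_def)
qed

lemma cond_law_abs_less:
  assumes "valid_params \<gamma>" "0 < c"
  shows "measure (cond_law \<gamma> \<nu>) {x. \<bar>x\<bar> < c * sqrt (sigma2 \<gamma>)}
    = 1 - 2 * normal_tail (if \<nu> then c / sqrt (par_u \<gamma> + 1) else c)"
proof -
  interpret prob_space "cond_law \<gamma> \<nu>" by (rule prob_space_cond_law[OF assms(1)])
  have sp: "space (cond_law \<gamma> \<nu>) = UNIV" by (simp add: cond_law_def)
  have "{x. \<bar>x\<bar> < c * sqrt (sigma2 \<gamma>)} = space (cond_law \<gamma> \<nu>) - {x. c * sqrt (sigma2 \<gamma>) \<le> \<bar>x\<bar>}"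
    by (auto simp: sp)
  then show ?thesis
    using cond_law_abs_ge[OF assms, of \<nu>] by (simp add: prob_compl)
qed

lemma bayes_risk_threshold_rule:
  assumes "valid_params \<gamma>" "0 < c"
  shows "bayes_risk \<gamma> m (threshold_rule \<gamma> c) = real m * p \<gamma> * deltaA \<gamma> * scaled_risk \<gamma> c"
proof -
  let ?S = "{x. c * sqrt (sigma2 \<gamma>) \<le> \<bar>x\<bar>}"
  have s: "0 < sigma2 \<gamma>" using assms by (simp add: valid_params_def)
  have "bayes_risk \<gamma> m (threshold_rule \<gamma> c) = (\<Sum>i\<in>{1..m}.
      delta0 \<gamma> * measure (model \<gamma> m) {\<omega> \<in> space (model \<gamma> m). fst (\<omega> i) = False \<and> snd (\<omega> i) \<in> ?S}
    + deltaA \<gamma> * measure (model \<gamma> m) {\<omega> \<in> space (model \<gamma> m). fst (\<omega> i) = True \<and> snd (\<omega> i) \<in> {x. \<bar>x\<bar> < c * sqrt (sigma2 \<gamma>)}})"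
    unfolding bayes_risk_eq_sum[OF assms(1) measurable_threshold_rule]
    by (intro sum.cong refl arg_cong2[where f = "(+)"] arg_cong[where f = "\<lambda>A. _ * measure _ A"])
       (auto simp: threshold_rule_def observed_def threshold_iff[OF s assms(2)])
  also have "\<dots> = (\<Sum>i\<in>{1..m}. delta0 \<gamma> * (1 - p \<gamma>) * (2 * normal_tail c)
      + deltaA \<gamma> * p \<gamma> * (1 - 2 * normal_tail (c / sqrt (par_u \<gamma> + 1))))"
  proof (rule sum.cong[OF refl])
    fix i assume i: "i \<in> {1..m}"
    have "?S \<in> sets borel" "{x. \<bar>x\<bar> < c * sqrt (sigma2 \<gamma>)} \<in> sets borel"
      by measurable
    note * = this[THEN prob_single_test[OF assms(1) i]]
    show "delta0 \<gamma> * measure (model \<gamma> m) {\<omega> \<in> space (model \<gamma> m). fst (\<omega> i) = False \<and> snd (\<omega> i) \<in> ?S}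
        + deltaA \<gamma> * measure (model \<gamma> m) {\<omega> \<in> space (model \<gamma> m). fst (\<omega> i) = True \<and> snd (\<omega> i) \<in> {x. \<bar>x\<bar> < c * sqrt (sigma2 \<gamma>)}}
      = delta0 \<gamma> * (1 - p \<gamma>) * (2 * normal_tail c)
        + deltaA \<gamma> * p \<gamma> * (1 - 2 * normal_tail (c / sqrt (par_u \<gamma> + 1)))"
      unfolding * cond_law_abs_ge[OF assms] cond_law_abs_less[OF assms] by simp
  qed
  also have "\<dots> = real m * p \<gamma> * deltaA \<gamma> * scaled_risk \<gamma> c"
    using assms by (simp add: scaled_risk_def par_f_def par_delta_def valid_params_def field_simps)
  finally show ?thesis .
qed

section \<open>Lower bound for the risk of an arbitrary rule\<close>

text \<open>The level at which and above which the Bayes oracle rejects, on the scale of \<open>x\<^sup>2 / \<sigma>\<^sup>2\<close>. It may be negative.\<close>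

definition oracle_level :: "params \<Rightarrow> real" where
  "oracle_level \<gamma> = (1 + 1 / par_u \<gamma>) * (ln (par_v \<gamma>) + ln (1 + 1 / par_u \<gamma>))"

lemma valid_params_pos:
  assumes "valid_params \<gamma>"
  shows "0 < par_u \<gamma>" "0 < par_f \<gamma>" "0 < par_delta \<gamma>" "0 < par_v \<gamma>"
  using assms by (auto simp: valid_params_def par_u_def par_f_def par_delta_def par_v_def)

text \<open>Below the oracle level, the expected cost of rejecting dominates that of accepting.\<close>

lemma density_domination:
  assumes "valid_params \<gamma>" and x: "x\<^sup>2 / sigma2 \<gamma> \<le> oracle_level \<gamma>"
  shows "deltaA \<gamma> * p \<gamma> * normal_density 0 (sqrt (sigma2 \<gamma> + tau2 \<gamma>)) x
    \<le> delta0 \<gamma> * (1 - p \<gamma>) * normal_density 0 (sqrt (sigma2 \<gamma>)) x"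
proof -
  define s u y where "s = sigma2 \<gamma>" and "u = par_u \<gamma>" and "y = x\<^sup>2 / s"
  note pos = valid_params_pos[OF assms(1)]
  have s: "s > 0" and u: "u > 0" and st: "sigma2 \<gamma> + tau2 \<gamma> = s * (u + 1)"
    using assms(1) pos by (auto simp: s_def u_def par_u_def valid_params_def field_simps)
  define w where "w = par_f \<gamma> * par_delta \<gamma>"
  have w: "w > 0" using pos by (simp add: w_def)
  have v: "par_v \<gamma> = u * w\<^sup>2"
    by (simp add: par_v_def u_def w_def power_mult_distrib)
  have "ln (par_v \<gamma>) + ln (1 + 1 / u) = ln (u * w\<^sup>2 * (1 + 1 / u))"
    unfolding v using u w by (subst ln_mult_pos) (auto simp: add_pos_pos)
  also have "u * w\<^sup>2 * (1 + 1 / u) = (w * sqrt (u + 1))\<^sup>2"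
    using u by (simp add: power_mult_distrib field_simps)
  also have "ln \<dots> = 2 * ln (w * sqrt (u + 1))"
    using u w by (simp add: ln_realpow)
  finally have level: "oracle_level \<gamma> = (1 + 1 / u) * (2 * ln (w * sqrt (u + 1)))"
    by (simp add: oracle_level_def u_def)
  have "y \<le> (1 + 1 / u) * (2 * ln (w * sqrt (u + 1)))"
    using x unfolding level by (simp add: y_def s_def)
  then have "y / 2 - y / (2 * (u + 1)) \<le> ln (w * sqrt (u + 1))"
    using u by (simp add: field_simps)
  then have "exp (y / 2 - y / (2 * (u + 1))) \<le> w * sqrt (u + 1)"
    using u w by (subst ln_ge_iff[symmetric]) auto
  then have "exp (- y / (2 * (u + 1))) \<le> exp (- y / 2) * (w * sqrt (u + 1))"
  proof -
    have "exp (- y / (2 * (u + 1))) = exp (- y / 2) * exp (y / 2 - y / (2 * (u + 1)))"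
      by (simp flip: exp_add)
    also assume "exp (y / 2 - y / (2 * (u + 1))) \<le> w * sqrt (u + 1)"
    finally show ?thesis by simp
  qed
  then have *: "exp (- y / (2 * (u + 1))) / sqrt (u + 1) \<le> w * exp (- y / 2)"
    using u by (simp add: field_simps)
  have d1: "normal_density 0 (sqrt (sigma2 \<gamma> + tau2 \<gamma>)) x
      = exp (- y / (2 * (u + 1))) / sqrt (u + 1) / sqrt (2 * pi * s)"
  proof -
    have "sqrt (2 * pi * (s * (u + 1))) = sqrt (u + 1) * sqrt (2 * pi * s)"
      by (simp add: real_sqrt_mult)
    moreover have "- (x\<^sup>2 / (2 * (s * (u + 1)))) = - y / (2 * (u + 1))"
      by (simp add: y_def)
    ultimately show ?thesis
      using s u by (simp add: normal_density_def st)
  qed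
  have d0: "normal_density 0 (sqrt (sigma2 \<gamma>)) x = exp (- y / 2) / sqrt (2 * pi * s)"
    using s by (simp add: normal_density_def y_def s_def field_simps)
  have cost: "delta0 \<gamma> * (1 - p \<gamma>) = deltaA \<gamma> * p \<gamma> * w"
    using assms(1) by (simp add: w_def par_f_def par_delta_def valid_params_def)
  have "exp (- y / (2 * (u + 1))) / sqrt (u + 1) / sqrt (2 * pi * s) \<le> w * exp (- y / 2) / sqrt (2 * pi * s)"
    by (rule divide_right_mono[OF *]) (use s in simp)
  then have "deltaA \<gamma> * p \<gamma> * (exp (- y / (2 * (u + 1))) / sqrt (u + 1) / sqrt (2 * pi * s))
      \<le> deltaA \<gamma> * p \<gamma> * (w * exp (- y / 2) / sqrt (2 * pi * s))"
    by (rule mult_left_mono) (use assms(1) in \<open>simp add: valid_params_def\<close>)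
  then show ?thesis
    unfolding d1 d0 cost by (simp add: mult.assoc)
qed

lemma test_law_domination:
  assumes "valid_params \<gamma>" "T \<in> sets borel"
    and T: "\<And>x. x \<in> T \<Longrightarrow> x\<^sup>2 / sigma2 \<gamma> \<le> oracle_level \<gamma>"
  shows "ennreal (deltaA \<gamma>) * emeasure (test_law \<gamma>) ({True} \<times> T)
    \<le> ennreal (delta0 \<gamma>) * emeasure (test_law \<gamma>) ({False} \<times> T)"
proof -
  let ?d = "\<lambda>\<nu>. normal_density 0 (sqrt (if \<nu> then sigma2 \<gamma> + tau2 \<gamma> else sigma2 \<gamma>))"
  have pos: "0 \<le> deltaA \<gamma> * p \<gamma>" "0 \<le> delta0 \<gamma> * (1 - p \<gamma>)" "0 \<le> deltaA \<gamma>" "0 \<le> delta0 \<gamma>"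
    using assms(1) by (auto simp: valid_params_def)
  have eq: "ennreal a * (ennreal b * emeasure (cond_law \<gamma> \<nu>) T)
      = (\<integral>\<^sup>+x. ennreal (a * b * ?d \<nu> x) * indicator T x \<partial>lborel)" if "0 \<le> a" "0 \<le> a * b" for a b \<nu>
  proof -
    have "ennreal a * (ennreal b * emeasure (cond_law \<gamma> \<nu>) T)
        = ennreal (a * b) * (\<integral>\<^sup>+x. ennreal (?d \<nu> x) * indicator T x \<partial>lborel)"
      using assms(2) that by (simp add: cond_law_def emeasure_density ennreal_mult' mult.assoc)
    also have "\<dots> = (\<integral>\<^sup>+x. ennreal (a * b) * (ennreal (?d \<nu> x) * indicator T x) \<partial>lborel)"
      using assms(2) by (subst nn_integral_cmult) auto
    also have "\<dots> = (\<integral>\<^sup>+x. ennreal (a * b * ?d \<nu> x) * indicator T x \<partial>lborel)"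
      using that(2) by (intro nn_integral_cong, subst ennreal_mult'[of "a * b"]) (simp_all only: mult.assoc)
    finally show ?thesis .
  qed
  have "(\<integral>\<^sup>+x. ennreal (deltaA \<gamma> * p \<gamma> * ?d True x) * indicator T x \<partial>lborel)
      \<le> (\<integral>\<^sup>+x. ennreal (delta0 \<gamma> * (1 - p \<gamma>) * ?d False x) * indicator T x \<partial>lborel)"
    using density_domination[OF assms(1) T]
    by (intro nn_integral_mono) (auto simp: indicator_def intro!: ennreal_leI)
  then show ?thesis
    using pos by (simp add: emeasure_test_law[OF assms(1,2)] eq)
qed

text \<open>
  The decision on the \<open>i\<close>-th test may depend on all observations. Conditioning on the other
  coordinates turns the event of a rejection at \<open>i\<close> into a set of values of \<open>X\<^sub>i\<close> alone, and this set
  is the same for \<open>\<nu>\<^sub>i = 0\<close> and \<open>\<nu>\<^sub>i = 1\<close>, since the rule does not see \<open>\<nu>\<^sub>i\<close>. So the domination for a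
  single test applies fibrewise.
\<close>

lemma rejection_cost_domination:
  assumes "valid_params \<gamma>" "measurable_rule m r" "i \<in> {1..m}" "S \<in> sets borel"
    and S: "\<And>x. x \<in> S \<Longrightarrow> x\<^sup>2 / sigma2 \<gamma> \<le> oracle_level \<gamma>"
  defines "A \<equiv> \<lambda>\<nu>. {\<omega> \<in> space (model \<gamma> m). fst (\<omega> i) = \<nu> \<and> snd (\<omega> i) \<in> S \<and> r (observed m \<omega>) i}"
  shows "deltaA \<gamma> * measure (model \<gamma> m) (A True) \<le> delta0 \<gamma> * measure (model \<gamma> m) (A False)"
proof -
  interpret M: prob_space "model \<gamma> m" by (rule prob_space_model[OF assms(1)])
  interpret T: prob_space "test_law \<gamma>" by (rule prob_space_test_law[OF assms(1)])
  interpret P: product_sigma_finite "\<lambda>_::nat. test_law \<gamma>"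
    by unfold_locales
  have pos: "0 \<le> deltaA \<gamma>" "0 \<le> delta0 \<gamma>"
    using assms(1) by (auto simp: valid_params_def)
  note [measurable] = measurable_observation[OF assms(1,3)] measurable_decision[OF assms(1-3)] assms(4)
  have A_sets [measurable]: "A \<nu> \<in> sets (model \<gamma> m)" for \<nu>
    unfolding A_def by measurable
  define I where "I = {1..m} - {i}"
  have I: "insert i I = {1..m}" "finite I" "i \<notin> I"
    using assms(3) by (auto simp: I_def)
  define T where "T = (\<lambda>\<omega>. {x \<in> S. r ((observed m \<omega>)(i := x)) i})"
  have T_borel: "T \<omega> \<in> sets borel" for \<omega>
  proof -
    have "(\<lambda>x. (observed m \<omega>)(i := x)) \<in> measurable borel (\<Pi>\<^sub>M j\<in>{1..m}. borel)"
      by (rule measurable_fun_upd[where J = "{1..m}"])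
         (use assms(3) in \<open>auto simp: space_PiM observed_def\<close>)
    from measurable_compose[OF this, of "\<lambda>x. r x i"]
    have [measurable]: "Measurable.pred borel (\<lambda>x. r ((observed m \<omega>)(i := x)) i)"
      using assms(2,3) by (auto simp: measurable_rule_def)
    show ?thesis
      unfolding T_def by measurable
  qed
  have em: "c * emeasure (model \<gamma> m) (A \<nu>)
      = (\<integral>\<^sup>+\<omega>. c * emeasure (test_law \<gamma>) ({\<nu>} \<times> T \<omega>) \<partial>(\<Pi>\<^sub>M i\<in>I. test_law \<gamma>))" for \<nu> c
  proof -
    \<comment> \<open>With the constant inside the integral from the start, the measurability of the fibre
        measure as a function of the other coordinates is never needed.\<close>
    define F :: "(nat \<Rightarrow> bool \<times> real) \<Rightarrow> ennreal" where "F = (\<lambda>\<omega>. c * indicator (A \<nu>) \<omega>)"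
    have "c * emeasure (model \<gamma> m) (A \<nu>) = integral\<^sup>N (model \<gamma> m) F"
      unfolding F_def by (simp add: nn_integral_cmult)
    also have "\<dots> = (\<integral>\<^sup>+h. (\<integral>\<^sup>+y. F (h(i := y)) \<partial>(test_law \<gamma>)) \<partial>(\<Pi>\<^sub>M i\<in>I. test_law \<gamma>))"
      unfolding model_def I(1)[symmetric]
      by (rule P.product_nn_integral_insert[OF I(2,3)])
         (use A_sets[of \<nu>] in \<open>auto simp: F_def model_def I(1)\<close>)
    also have "\<dots> = (\<integral>\<^sup>+h. c * emeasure (test_law \<gamma>) ({\<nu>} \<times> T h) \<partial>(\<Pi>\<^sub>M i\<in>I. test_law \<gamma>))"
    proof (rule nn_integral_cong)
      fix h assume h: "h \<in> space (\<Pi>\<^sub>M i\<in>I. test_law \<gamma>)"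
      have sp: "space (test_law \<gamma>) = UNIV"
        using sets_eq_imp_space_eq[OF sets_test_law[OF assms(1)]] by (simp add: space_pair_measure)
      have "h(i := y) \<in> space (model \<gamma> m)" for y
        using h unfolding model_def I(1)[symmetric] by (auto simp: space_PiM sp PiE_iff extensional_def)
      moreover have "observed m (h(i := y)) = (observed m h)(i := snd y)" for y
        using assms(3) by (auto simp: observed_def)
      ultimately have "F (h(i := y)) = c * indicator ({\<nu>} \<times> T h) y" for y
        by (cases y) (auto simp: F_def A_def T_def indicator_def)
      then show "(\<integral>\<^sup>+y. F (h(i := y)) \<partial>(test_law \<gamma>)) = c * emeasure (test_law \<gamma>) ({\<nu>} \<times> T h)"
        using T_borel[of h] by (simp add: sets_test_law[OF assms(1)] nn_integral_cmult_indicator)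
    qed
    finally show ?thesis .
  qed
  have "ennreal (deltaA \<gamma>) * emeasure (model \<gamma> m) (A True)
      = (\<integral>\<^sup>+\<omega>. ennreal (deltaA \<gamma>) * emeasure (test_law \<gamma>) ({True} \<times> T \<omega>) \<partial>(\<Pi>\<^sub>M i\<in>I. test_law \<gamma>))"
    by (rule em)
  also have "\<dots> \<le> (\<integral>\<^sup>+\<omega>. ennreal (delta0 \<gamma>) * emeasure (test_law \<gamma>) ({False} \<times> T \<omega>) \<partial>(\<Pi>\<^sub>M i\<in>I. test_law \<gamma>))"
    by (intro nn_integral_mono test_law_domination[OF assms(1) T_borel] S) (auto simp: T_def)
  also have "\<dots> = ennreal (delta0 \<gamma>) * emeasure (model \<gamma> m) (A False)"
    by (rule em[symmetric])
  finally show ?thesis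
    using pos by (simp add: M.emeasure_eq_measure ennreal_mult'[symmetric] ennreal_le_iff)
qed

text \<open>
  No rule can beat the type II part of the risk of a threshold that is at most the oracle threshold:
  whenever the rule rejects with \<open>X\<^sub>i\<^sup>2 / \<sigma>\<^sup>2 < k\<^sup>2\<close>, the type II errors so avoided cost no more than the type I
  errors so incurred.
\<close>

lemma bayes_risk_lower_bound:
  assumes "valid_params \<gamma>" "measurable_rule m r" "0 < k" "k\<^sup>2 \<le> oracle_level \<gamma>"
  shows "real m * p \<gamma> * deltaA \<gamma> * (1 - 2 * normal_tail (k / sqrt (par_u \<gamma> + 1))) \<le> bayes_risk \<gamma> m r"
proof -
  interpret M: prob_space "model \<gamma> m" by (rule prob_space_model[OF assms(1)])
  let ?P = "measure (model \<gamma> m)"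
  have pos: "0 \<le> deltaA \<gamma>" "0 \<le> delta0 \<gamma>" and s: "0 < sigma2 \<gamma>"
    using assms(1) by (auto simp: valid_params_def)
  define S where "S = {x. \<bar>x\<bar> < k * sqrt (sigma2 \<gamma>)}"
  have S_borel [measurable]: "S \<in> sets borel"
    unfolding S_def by measurable
  have S: "x\<^sup>2 / sigma2 \<gamma> \<le> oracle_level \<gamma>" if "x \<in> S" for x
    using that threshold_iff[OF s assms(3), of x] assms(4) by (auto simp: S_def)
  have "real m * p \<gamma> * deltaA \<gamma> * (1 - 2 * normal_tail (k / sqrt (par_u \<gamma> + 1)))
      = (\<Sum>i\<in>{1..m}. deltaA \<gamma> * (p \<gamma> * measure (cond_law \<gamma> True) S))"
    unfolding S_def cond_law_abs_less[OF assms(1,3)] by simp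
  also have "\<dots> \<le> (\<Sum>i\<in>{1..m}.
      delta0 \<gamma> * ?P {\<omega> \<in> space (model \<gamma> m). \<not> fst (\<omega> i) \<and> r (observed m \<omega>) i}
    + deltaA \<gamma> * ?P {\<omega> \<in> space (model \<gamma> m). fst (\<omega> i) \<and> \<not> r (observed m \<omega>) i})"
  proof (rule sum_mono)
    fix i assume i: "i \<in> {1..m}"
    note [measurable] = measurable_observation[OF assms(1) i] measurable_decision[OF assms(1,2) i]
    define A where "A = (\<lambda>\<nu>. {\<omega> \<in> space (model \<gamma> m). fst (\<omega> i) = \<nu> \<and> snd (\<omega> i) \<in> S \<and> r (observed m \<omega>) i})"
    have [measurable]: "A \<nu> \<in> sets (model \<gamma> m)" for \<nu>
      unfolding A_def by measurable
    have "p \<gamma> * measure (cond_law \<gamma> True) S = ?P {\<omega> \<in> space (model \<gamma> m). fst (\<omega> i) = True \<and> snd (\<omega> i) \<in> S}"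
      using prob_single_test[OF assms(1) i S_borel, of True] by simp
    also have "\<dots> \<le> ?P (A True \<union> {\<omega> \<in> space (model \<gamma> m). fst (\<omega> i) \<and> \<not> r (observed m \<omega>) i})"
      by (rule M.finite_measure_mono) (auto simp: A_def)
    also have "\<dots> \<le> ?P (A True) + ?P {\<omega> \<in> space (model \<gamma> m). fst (\<omega> i) \<and> \<not> r (observed m \<omega>) i}"
      by (rule measure_Un_le) measurable
    finally have "deltaA \<gamma> * (p \<gamma> * measure (cond_law \<gamma> True) S)
        \<le> deltaA \<gamma> * ?P (A True) + deltaA \<gamma> * ?P {\<omega> \<in> space (model \<gamma> m). fst (\<omega> i) \<and> \<not> r (observed m \<omega>) i}"
      using pos(1) by (simp add: mult_left_mono flip: distrib_left)
    moreover have "deltaA \<gamma> * ?P (A True) \<le> delta0 \<gamma> * ?P (A False)"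
      unfolding A_def by (rule rejection_cost_domination[OF assms(1,2) i S_borel S])
    moreover have "delta0 \<gamma> * ?P (A False)
        \<le> delta0 \<gamma> * ?P {\<omega> \<in> space (model \<gamma> m). \<not> fst (\<omega> i) \<and> r (observed m \<omega>) i}"
      by (intro mult_left_mono[OF _ pos(2)] M.finite_measure_mono) (auto simp: A_def)
    ultimately show "deltaA \<gamma> * (p \<gamma> * measure (cond_law \<gamma> True) S)
      \<le> delta0 \<gamma> * ?P {\<omega> \<in> space (model \<gamma> m). \<not> fst (\<omega> i) \<and> r (observed m \<omega>) i}
        + deltaA \<gamma> * ?P {\<omega> \<in> space (model \<gamma> m). fst (\<omega> i) \<and> \<not> r (observed m \<omega>) i}"
      by linarith
  qed
  also have "\<dots> = bayes_risk \<gamma> m r"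
    by (rule bayes_risk_eq_sum[OF assms(1,2), symmetric])
  finally show ?thesis .
qed

lemma optimal_risk_bounds:
  assumes "valid_params \<gamma>" "0 < k" "k\<^sup>2 \<le> oracle_level \<gamma>"
  shows "real m * p \<gamma> * deltaA \<gamma> * (1 - 2 * normal_tail (k / sqrt (par_u \<gamma> + 1))) \<le> optimal_risk \<gamma> m"
    and "optimal_risk \<gamma> m \<le> real m * p \<gamma> * deltaA \<gamma> * scaled_risk \<gamma> k"
proof -
  have mem: "threshold_rule \<gamma> k \<in> {r. measurable_rule m r}"
    by (simp add: measurable_threshold_rule)
  show "real m * p \<gamma> * deltaA \<gamma> * (1 - 2 * normal_tail (k / sqrt (par_u \<gamma> + 1))) \<le> optimal_risk \<gamma> m"
    unfolding optimal_risk_def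
    by (rule cINF_greatest) (use mem bayes_risk_lower_bound[OF assms(1) _ assms(2,3)] in auto)
  show "optimal_risk \<gamma> m \<le> real m * p \<gamma> * deltaA \<gamma> * scaled_risk \<gamma> k"
    unfolding optimal_risk_def bayes_risk_threshold_rule[OF assms(1,2), symmetric]
    using bayes_risk_lower_bound[OF assms(1) _ assms(2,3)]
    by (intro cINF_lower bdd_belowI2[where m = "real m * p \<gamma> * deltaA \<gamma> * (1 - 2 * normal_tail (k / sqrt (par_u \<gamma> + 1)))"])
       (use mem in auto)
qed

lemma normal_tail_less_half:
  assumes "0 < x"
  shows "normal_tail x < 1 / 2"
proof -
  interpret prob_space "density lborel std_normal_density"
    by (rule prob_space_normal_density) simp
  have "2 * normal_tail (x / 2) \<le> 1"
    using measure_normal_abs_ge[of 1 "x / 2"] assms prob_le_1[of "{y. x / 2 \<le> \<bar>y\<bar>}"] by simp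
  moreover have "normal_tail x < normal_tail (x / 2)"
    using assms by (intro normal_tail_less) simp
  ultimately show ?thesis by simp
qed

section \<open>The equations for the two thresholds\<close>

text \<open>
  The ratio of the rejection probabilities under the null and under the alternative, for the
  threshold \<open>c > 0\<close>.
\<close>

definition tail_ratio :: "params \<Rightarrow> real \<Rightarrow> real" where
  "tail_ratio \<gamma> c = normal_tail c / normal_tail (c / sqrt (par_u \<gamma> + 1))"

lemma tail_ratio_pos: "0 < tail_ratio \<gamma> c"
  by (simp add: tail_ratio_def normal_tail_pos)

lemma tail_ratio_less_1_imp_pos:
  assumes "valid_params \<gamma>" "tail_ratio \<gamma> c < 1"
  shows "0 < c"
proof (rule ccontr)
  assume "\<not> 0 < c"
  moreover have "1 \<le> sqrt (par_u \<gamma> + 1)"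
    using valid_params_pos(1)[OF assms(1)] by simp
  ultimately have "c \<le> c / sqrt (par_u \<gamma> + 1)"
    using divide_right_mono_neg[of 1 "sqrt (par_u \<gamma> + 1)" c] mult_left_mono_neg[of 1 "sqrt (par_u \<gamma> + 1)" c]
    by (simp add: field_simps)
  then have "normal_tail (c / sqrt (par_u \<gamma> + 1)) \<le> normal_tail c"
    by (rule normal_tail_antimono)
  then show False
    using assms(2) by (simp add: tail_ratio_def normal_tail_pos)
qed

lemma solves_GW_iff:
  assumes "valid_params \<gamma>" "0 < \<alpha>" "\<alpha> < 1 - p \<gamma>"
  shows "solves_GW \<gamma> \<alpha> c \<longleftrightarrow> tail_ratio \<gamma> c = \<alpha> * p \<gamma> / (1 - \<alpha> * (1 - p \<gamma>))"
proof -
  define g h q where "g = normal_tail c" and "h = normal_tail (c / sqrt (par_u \<gamma> + 1))" and "q = p \<gamma>"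
  have gh: "g > 0" "h > 0" by (simp_all add: g_def h_def normal_tail_pos)
  have q: "0 < q" "q < 1" using assms by (auto simp: valid_params_def q_def)
  have "\<alpha> * (1 - q) < 1"
    using mult_strict_mono[of \<alpha> 1 "1 - q" 1] assms q by (simp add: q_def)
  moreover have "(1 - q) * g + q * h > 0" using gh q by (simp add: add_pos_pos)
  moreover have "solves_GW \<gamma> \<alpha> c \<longleftrightarrow> g / ((1 - q) * g + q * h) = \<alpha>"
    by (simp add: solves_GW_def g_def h_def q_def normal_tail_def)
  ultimately show ?thesis
    unfolding tail_ratio_def g_def[symmetric] h_def[symmetric] q_def[symmetric]
    using gh by (simp add: divide_eq_eq eq_divide_eq) (auto simp: algebra_simps)
qed

lemma solves_B_iff:
  assumes "valid_params \<gamma>" "0 < \<alpha>" "\<alpha> < 1 - p \<gamma>"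
  shows "solves_B \<gamma> \<alpha> c \<longleftrightarrow> tail_ratio \<gamma> c = \<alpha> * p \<gamma> / ((1 - p \<gamma>) * (1 - \<alpha>))"
proof -
  define g h q where "g = normal_tail c" and "h = normal_tail (c / sqrt (par_u \<gamma> + 1))" and "q = p \<gamma>"
  have gh: "g > 0" "h > 0" by (simp_all add: g_def h_def normal_tail_pos)
  have q: "0 < q" "q < 1" using assms by (auto simp: valid_params_def q_def)
  have "(1 - q) * (1 - \<alpha>) > 0"
    using assms q by (simp add: q_def)
  moreover have "(1 - q) * g + q * h > 0" using gh q by (simp add: add_pos_pos)
  moreover have "solves_B \<gamma> \<alpha> c \<longleftrightarrow> (1 - q) * g / ((1 - q) * g + q * h) = \<alpha>"
    by (simp add: solves_B_def g_def h_def q_def normal_tail_def)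
  ultimately show ?thesis
    unfolding tail_ratio_def g_def[symmetric] h_def[symmetric] q_def[symmetric]
    using gh by (simp add: divide_eq_eq eq_divide_eq) (auto simp: algebra_simps)
qed

lemma solves_GW_pos:
  assumes "valid_params \<gamma>" "0 < \<alpha>" "\<alpha> < 1 - p \<gamma>" "solves_GW \<gamma> \<alpha> c"
  shows "0 < c"
proof (rule tail_ratio_less_1_imp_pos[OF assms(1)])
  have q: "0 < p \<gamma>" "p \<gamma> < 1" using assms by (auto simp: valid_params_def)
  have "\<alpha> * (1 - p \<gamma>) < 1"
    using mult_strict_mono[of \<alpha> 1 "1 - p \<gamma>" 1] assms q by simp
  then show "tail_ratio \<gamma> c < 1"
    using assms(4) q assms(2,3) unfolding solves_GW_iff[OF assms(1-3)]
    by (simp add: divide_less_eq algebra_simps)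
qed

lemma solves_B_pos:
  assumes "valid_params \<gamma>" "0 < \<alpha>" "\<alpha> < 1 - p \<gamma>" "solves_B \<gamma> \<alpha> c"
  shows "0 < c"
proof (rule tail_ratio_less_1_imp_pos[OF assms(1)])
  have q: "0 < p \<gamma>" "p \<gamma> < 1" using assms by (auto simp: valid_params_def)
  have "(1 - p \<gamma>) * (1 - \<alpha>) > 0"
    using assms(2,3) q by simp
  then show "tail_ratio \<gamma> c < 1"
    using assms(4) q assms(2,3) unfolding solves_B_iff[OF assms(1-3)]
    by (simp add: divide_less_eq algebra_simps)
qed

lemma tail_ratio_GW_B:
  assumes "valid_params \<gamma>" "0 < \<alpha>" "\<alpha> < 1 - p \<gamma>" "solves_GW \<gamma> \<alpha> c" "solves_B \<gamma> \<alpha> c'"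
  shows "tail_ratio \<gamma> c / tail_ratio \<gamma> c' = (1 - p \<gamma>) * (1 - tail_ratio \<gamma> c)"
proof -
  have q: "0 < p \<gamma>" "p \<gamma> < 1" using assms by (auto simp: valid_params_def)
  have "\<alpha> * (1 - p \<gamma>) < 1"
    using mult_strict_mono[of \<alpha> 1 "1 - p \<gamma>" 1] assms q by simp
  moreover define d where "d = 1 - \<alpha> * (1 - p \<gamma>)"
  ultimately have d: "d > 0" by simp
  have "1 - \<alpha> * p \<gamma> / d = (1 - \<alpha>) / d"
    using d by (simp add: field_simps) (simp add: d_def algebra_simps)
  moreover have "tail_ratio \<gamma> c = \<alpha> * p \<gamma> / d"
    using assms(4) unfolding solves_GW_iff[OF assms(1-3)] d_def .
  moreover have "tail_ratio \<gamma> c' = \<alpha> * p \<gamma> / ((1 - p \<gamma>) * (1 - \<alpha>))"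
    using assms(5) unfolding solves_B_iff[OF assms(1-3)] .
  ultimately show ?thesis
    using assms(2) q by simp
qed

text \<open>
  The squares of two thresholds are close if their tail ratios are nearly equal: \<open>ln Q(c)\<close> falls at
  least as fast as \<open>-c\<^sup>2 / 2\<close>, whereas \<open>ln Q(c / a)\<close> falls only by a small fraction of this when \<open>a\<close> and
  \<open>a x\<close> are large. There is no condition on which of \<open>x\<close> and \<open>y\<close> is the larger.
\<close>

lemma tail_ratio_gap:
  assumes "valid_params \<gamma>" "0 < x" "0 < y"
  defines "a \<equiv> sqrt (par_u \<gamma> + 1)"
  shows "\<bar>x\<^sup>2 - y\<^sup>2\<bar> * (1 / 2 - 1 / (2 * a\<^sup>2) - 1 / (a * x)) \<le> \<bar>ln (tail_ratio \<gamma> x / tail_ratio \<gamma> y)\<bar>"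
proof -
  have a: "a > 0" using valid_params_pos(1)[OF assms(1)] by (simp add: a_def)
  have ln_r: "ln (tail_ratio \<gamma> x / tail_ratio \<gamma> y)
      = (ln (normal_tail x) - ln (normal_tail y)) - (ln (normal_tail (x / a)) - ln (normal_tail (y / a)))" for x y
  proof -
    have "ln (tail_ratio \<gamma> z) = ln (normal_tail z) - ln (normal_tail (z / a))" for z
      unfolding tail_ratio_def a_def by (rule ln_divide_pos[OF normal_tail_pos normal_tail_pos])
    then show ?thesis
      using ln_divide_pos[OF tail_ratio_pos tail_ratio_pos, of \<gamma> x \<gamma> y] by simp
  qed
  have key: "(y\<^sup>2 - x\<^sup>2) * (1 / 2 - 1 / (2 * a\<^sup>2) - 1 / (a * z)) \<le> ln (tail_ratio \<gamma> x / tail_ratio \<gamma> y)"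
    if "0 < x" "x \<le> y" and z: "0 < z" "z \<le> y" for x y z
  proof -
    have "y - x \<le> (y\<^sup>2 - x\<^sup>2) / z"
    proof -
      have "(y - x) * z \<le> (y - x) * (y + x)"
        using that by (intro mult_left_mono) auto
      also have "\<dots> = y\<^sup>2 - x\<^sup>2"
        by (simp add: power2_eq_square algebra_simps)
      finally show ?thesis
        using z by (simp only: pos_le_divide_eq)
    qed
    then have "(y - x) / a \<le> (y\<^sup>2 - x\<^sup>2) / (a * z)"
      using divide_right_mono[of "y - x" "(y\<^sup>2 - x\<^sup>2) / z" a] a by (simp add: mult.commute)
    moreover have "(y\<^sup>2 - x\<^sup>2) / 2 \<le> ln (normal_tail x) - ln (normal_tail y)"
      by (rule ln_normal_tail_diff_ge) fact+
    moreover have "ln (normal_tail (x / a)) - ln (normal_tail (y / a))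
        \<le> ((y / a)\<^sup>2 - (x / a)\<^sup>2) / 2 + (y / a - x / a)"
      using that a by (intro ln_normal_tail_diff_le) (auto simp: divide_right_mono)
    moreover have "((y / a)\<^sup>2 - (x / a)\<^sup>2) / 2 + (y / a - x / a) = (y\<^sup>2 - x\<^sup>2) / (2 * a\<^sup>2) + (y - x) / a"
      by (simp add: power_divide diff_divide_distrib)
    moreover have "(y\<^sup>2 - x\<^sup>2) * (1 / 2 - 1 / (2 * a\<^sup>2) - 1 / (a * z))
        = (y\<^sup>2 - x\<^sup>2) / 2 - (y\<^sup>2 - x\<^sup>2) / (2 * a\<^sup>2) - (y\<^sup>2 - x\<^sup>2) / (a * z)"
      by (simp add: right_diff_distrib)
    ultimately show ?thesis
      unfolding ln_r by linarith
  qed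
  show ?thesis
  proof (cases "x \<le> y")
    case True
    then have "\<bar>x\<^sup>2 - y\<^sup>2\<bar> = y\<^sup>2 - x\<^sup>2"
      using assms by (simp add: abs_if power_strict_mono not_less)
    then show ?thesis
      using key[of x y x] assms True by simp
  next
    case False
    then have "\<bar>x\<^sup>2 - y\<^sup>2\<bar> = x\<^sup>2 - y\<^sup>2"
      using assms by (simp add: abs_if power_mono not_less)
    moreover have "ln (tail_ratio \<gamma> y / tail_ratio \<gamma> x) = - ln (tail_ratio \<gamma> x / tail_ratio \<gamma> y)"
      unfolding ln_r by simp
    ultimately show ?thesis
      using key[of y x x] assms False by simp
  qed
qed

section \<open>Asymptotics of the optimal risk\<close>

text \<open>
  A sequence of parameter vectors with \<open>u \<longlonglongrightarrow> \<infinity>\<close>, \<open>v \<longlonglongrightarrow> \<infinity>\<close> and \<open>ln v / u \<longlonglongrightarrow> C\<close>, where \<open>0 < C < \<infinity>\<close>. The abbreviation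
  \<open>w\<close> stands for \<open>f \<delta>\<close>, and \<open>a\<close> for the standard deviation of \<open>X / \<sigma>\<close> under the alternative.
\<close>

locale sparse_sequence =
  fixes \<gamma> :: "nat \<Rightarrow> params" and m :: "nat \<Rightarrow> nat" and C :: real
  assumes valid: "valid_params (\<gamma> t)"
    and m_pos: "m t \<ge> 1"
    and u_lim: "filterlim (\<lambda>t. par_u (\<gamma> t)) at_top sequentially"
    and v_lim: "filterlim (\<lambda>t. par_v (\<gamma> t)) at_top sequentially"
    and C_pos: "C > 0"
    and C_lim: "(\<lambda>t. ln (par_v (\<gamma> t)) / par_u (\<gamma> t)) \<longlonglongrightarrow> C"
begin

abbreviation u :: "nat \<Rightarrow> real" where "u t \<equiv> par_u (\<gamma> t)"
abbreviation v :: "nat \<Rightarrow> real" where "v t \<equiv> par_v (\<gamma> t)"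
abbreviation a :: "nat \<Rightarrow> real" where "a t \<equiv> sqrt (u t + 1)"
abbreviation w :: "nat \<Rightarrow> real" where "w t \<equiv> par_f (\<gamma> t) * par_delta (\<gamma> t)"

text \<open>The limiting type II error probability of the Bayes oracle.\<close>

abbreviation D :: real where "D \<equiv> 1 - 2 * normal_tail (sqrt C)"

lemma D_pos: "D > 0"
  using normal_tail_less_half[of "sqrt C"] C_pos by simp

lemma u_pos: "u t > 0" and v_pos: "v t > 0" and w_pos: "w t > 0" and a_pos: "a t > 0"
  using valid_params_pos[OF valid] by (simp_all add: add_pos_pos)

lemma w_eq: "w t = sqrt (v t / u t)"
proof -
  have "v t / u t = (w t)\<^sup>2"
    using u_pos[of t] by (simp add: par_v_def power_mult_distrib)
  then show ?thesis
    using w_pos[of t] by simp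
qed

lemma a_lim: "filterlim a at_top sequentially"
  by (rule filterlim_compose[OF _ u_lim]) real_asymp

lemma scaled_risk_eq: "scaled_risk (\<gamma> t) c = 2 * (w t * normal_tail c) + (1 - 2 * normal_tail (c / a t))"
  by (simp add: scaled_risk_def)

lemma detection_tendsto:
  assumes "(\<lambda>t. c t / a t) \<longlonglongrightarrow> l"
  shows "(\<lambda>t. 1 - 2 * normal_tail (c t / a t)) \<longlonglongrightarrow> 1 - 2 * normal_tail l"
  by (intro tendsto_intros isCont_tendsto_compose[OF isCont_normal_tail assms])

lemma scaled_risk_tendsto:
  assumes "(\<lambda>t. c t / a t) \<longlonglongrightarrow> sqrt C" "(\<lambda>t. w t * normal_tail (c t)) \<longlonglongrightarrow> 0"
  shows "(\<lambda>t. scaled_risk (\<gamma> t) (c t)) \<longlonglongrightarrow> D"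
  unfolding scaled_risk_eq
  using tendsto_add[OF tendsto_mult_left[OF assms(2), of 2] detection_tendsto[OF assms(1)]] by simp

text \<open>
  The threshold of the Bayes oracle. It is meaningful only once the oracle level is positive, hence
  for all large \<open>t\<close> (see \<open>k_eventually\<close>).
\<close>

definition k :: "nat \<Rightarrow> real" where "k t = sqrt (oracle_level (\<gamma> t))"

lemma oracle_level_ge: "ln (v t) \<ge> 0 \<Longrightarrow> oracle_level (\<gamma> t) \<ge> ln (v t)"
proof -
  assume "ln (v t) \<ge> 0"
  moreover have "ln (1 + 1 / u t) \<ge> 0" "1 + 1 / u t \<ge> 1"
    using u_pos[of t] by simp_all
  ultimately have "1 * (ln (v t) + 0) \<le> (1 + 1 / u t) * (ln (v t) + ln (1 + 1 / u t))"
    by (intro mult_mono) auto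
  then show ?thesis by (simp add: oracle_level_def)
qed

lemma k_eventually: "\<forall>\<^sub>F t in sequentially. 1 \<le> k t \<and> (k t)\<^sup>2 = oracle_level (\<gamma> t) \<and> ln (v t) \<le> (k t)\<^sup>2"
proof -
  have "filterlim (\<lambda>t. ln (v t)) at_top sequentially"
    by (rule filterlim_compose[OF ln_at_top v_lim])
  then have "\<forall>\<^sub>F t in sequentially. 1 \<le> ln (v t)"
    by (simp add: filterlim_at_top)
  then show ?thesis
  proof eventually_elim
    case (elim t)
    then have "oracle_level (\<gamma> t) \<ge> ln (v t)" by (intro oracle_level_ge) simp
    then show ?case using elim by (simp add: k_def)
  qed
qed

lemma k_over_a: "(\<lambda>t. k t / a t) \<longlonglongrightarrow> sqrt C"
proof -
  have "((\<lambda>u::real. ln (1 + 1 / u) / u) \<longlongrightarrow> 0) at_top"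
    by real_asymp
  from filterlim_compose[OF this u_lim] have "(\<lambda>t. ln (1 + 1 / u t) / u t) \<longlonglongrightarrow> 0" .
  from tendsto_add[OF C_lim this]
  have "(\<lambda>t. (ln (v t) + ln (1 + 1 / u t)) / u t) \<longlonglongrightarrow> C"
    by (simp add: add_divide_distrib)
  moreover have "(ln (v t) + ln (1 + 1 / u t)) / u t = oracle_level (\<gamma> t) / (u t + 1)" for t
  proof -
    have "L / x = (1 + 1 / x) * L / (x + 1)" if "0 < x" for L x :: real
      using that by (simp add: divide_simps)
    from this[OF u_pos] show ?thesis
      unfolding oracle_level_def .
  qed
  ultimately have "(\<lambda>t. oracle_level (\<gamma> t) / (u t + 1)) \<longlonglongrightarrow> C"
    by (simp only:)
  then have "(\<lambda>t. sqrt (oracle_level (\<gamma> t) / (u t + 1))) \<longlonglongrightarrow> sqrt C"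
    by (rule tendsto_real_sqrt)
  then show ?thesis
    by (simp add: k_def real_sqrt_divide)
qed

lemma k_type1: "(\<lambda>t. w t * normal_tail (k t)) \<longlonglongrightarrow> 0"
proof (rule tendsto_sandwich)
  show "\<forall>\<^sub>F t in sequentially. 0 \<le> w t * normal_tail (k t)"
    using w_pos normal_tail_pos by (simp add: less_imp_le)
  show "(\<lambda>t. 1 / sqrt (u t)) \<longlonglongrightarrow> 0"
    by (rule filterlim_compose[OF _ u_lim]) real_asymp
  show "\<forall>\<^sub>F t in sequentially. w t * normal_tail (k t) \<le> 1 / sqrt (u t)"
    using k_eventually
  proof eventually_elim
    case (elim t)
    have "std_normal_density (k t) / k t \<le> std_normal_density (k t) / 1"
      by (intro divide_left_mono) (use elim in auto)
    then have "normal_tail (k t) \<le> std_normal_density (k t)"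
      using normal_tail_le[of "k t"] elim by simp
    also have "\<dots> \<le> exp (- (k t)\<^sup>2 / 2)"
    proof -
      have "1 \<le> sqrt (2 * pi)" using pi_ge_two by simp
      then show ?thesis by (simp add: std_normal_density_def field_simps)
    qed
    also have "\<dots> \<le> exp (- ln (v t) / 2)"
      using elim by simp
    also have "\<dots> = 1 / sqrt (v t)"
      using v_pos[of t] by (simp add: exp_minus inverse_eq_divide ln_sqrt[symmetric])
    finally have "w t * normal_tail (k t) \<le> w t * (1 / sqrt (v t))"
      using w_pos[of t] by (intro mult_left_mono) auto
    also have "\<dots> = 1 / sqrt (u t)"
      using v_pos[of t] by (simp add: w_eq real_sqrt_divide)
    finally show ?case .
  qed
qed simp

lemma cost_pos: "real (m t) * p (\<gamma> t) * deltaA (\<gamma> t) > 0"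
  using valid[of t] m_pos[of t] by (simp add: valid_params_def)

lemma optimal_risk_tendsto:
  "(\<lambda>t. optimal_risk (\<gamma> t) (m t) / (real (m t) * p (\<gamma> t) * deltaA (\<gamma> t))) \<longlonglongrightarrow> D"
proof (rule tendsto_sandwich)
  show "(\<lambda>t. 1 - 2 * normal_tail (k t / a t)) \<longlonglongrightarrow> D"
    by (rule detection_tendsto[OF k_over_a])
  show "(\<lambda>t. scaled_risk (\<gamma> t) (k t)) \<longlonglongrightarrow> D"
    by (rule scaled_risk_tendsto[OF k_over_a k_type1])
  show "\<forall>\<^sub>F t in sequentially. 1 - 2 * normal_tail (k t / a t)
      \<le> optimal_risk (\<gamma> t) (m t) / (real (m t) * p (\<gamma> t) * deltaA (\<gamma> t))"
    using k_eventually
  proof eventually_elim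
    case (elim t)
    then show ?case
      using optimal_risk_bounds(1)[OF valid, of "k t" t "m t"] cost_pos[of t]
      by (simp add: pos_le_divide_eq mult.commute)
  qed
  show "\<forall>\<^sub>F t in sequentially. optimal_risk (\<gamma> t) (m t) / (real (m t) * p (\<gamma> t) * deltaA (\<gamma> t))
      \<le> scaled_risk (\<gamma> t) (k t)"
    using k_eventually
  proof eventually_elim
    case (elim t)
    then show ?case
      using optimal_risk_bounds(2)[OF valid, of "k t" t "m t"] cost_pos[of t]
      by (simp add: pos_divide_le_eq mult.commute)
  qed
qed

section \<open>Asymptotically optimal thresholds\<close>

lemma ABOS_iff_scaled_risk:
  assumes "\<And>t. c t > 0"
  shows "ABOS \<gamma> m (\<lambda>t. threshold_rule (\<gamma> t) (c t)) \<longleftrightarrow> (\<lambda>t. scaled_risk (\<gamma> t) (c t)) \<longlonglongrightarrow> D"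
proof -
  define b where "b t = real (m t) * p (\<gamma> t) * deltaA (\<gamma> t)" for t
  define R where "R t = optimal_risk (\<gamma> t) (m t) / b t" for t
  have b: "b t > 0" for t unfolding b_def by (rule cost_pos)
  have R: "R \<longlonglongrightarrow> D"
    using optimal_risk_tendsto by (simp add: R_def[abs_def] b_def)
  have eq: "bayes_risk (\<gamma> t) (m t) (threshold_rule (\<gamma> t) (c t)) / optimal_risk (\<gamma> t) (m t)
      = scaled_risk (\<gamma> t) (c t) / R t" for t
    using b[of t] by (simp add: bayes_risk_threshold_rule[OF valid assms] R_def b_def field_simps)
  have ev: "\<forall>\<^sub>F t in sequentially. R t > 0"
    using order_tendstoD(1)[OF R D_pos] .
  show ?thesis
    unfolding ABOS_def eq
  proof
    assume "(\<lambda>t. scaled_risk (\<gamma> t) (c t) / R t) \<longlonglongrightarrow> 1"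
    from tendsto_mult[OF this R] have "(\<lambda>t. scaled_risk (\<gamma> t) (c t) / R t * R t) \<longlonglongrightarrow> D"
      by simp
    then show "(\<lambda>t. scaled_risk (\<gamma> t) (c t)) \<longlonglongrightarrow> D"
      by (rule Lim_transform_eventually) (use ev in eventually_elim, simp)
  next
    assume "(\<lambda>t. scaled_risk (\<gamma> t) (c t)) \<longlonglongrightarrow> D"
    from tendsto_divide[OF this R] D_pos show "(\<lambda>t. scaled_risk (\<gamma> t) (c t) / R t) \<longlonglongrightarrow> 1"
      by simp
  qed
qed

text \<open>
  For \<open>s\<^sup>2 < C' < C\<close>, eventually \<open>v \<ge> exp (C' u)\<close>, so that \<open>w = sqrt (v / u)\<close> outweighs
  \<open>Q(s a)\<close>, which is of order \<open>exp (- s\<^sup>2 u / 2)\<close> up to a power of \<open>u\<close>.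
\<close>

lemma type1_diverges:
  assumes s: "0 < s" "s < sqrt C"
  shows "filterlim (\<lambda>t. w t * normal_tail (s * a t)) at_top sequentially"
proof -
  have "s\<^sup>2 < (sqrt C)\<^sup>2"
    by (rule power_strict_mono) (use s in auto)
  then have "s\<^sup>2 < C" using C_pos by simp
  then obtain C' where C': "s\<^sup>2 < C'" "C' < C" using dense by blast
  define K where "K = C' - s\<^sup>2"
  have K: "K > 0" using C' by (simp add: K_def)
  define g where "g = (\<lambda>x::real. exp (K * x / 2) * exp (- s\<^sup>2 / 2) / sqrt (2 * pi) / (sqrt x * (s * sqrt (x + 1) + 1)))"
  have "filterlim g at_top at_top"
  proof -
    define e where "e = exp (- s\<^sup>2 / 2) / sqrt (2 * pi)"
    have "e > 0" by (simp add: e_def)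
    then have "filterlim (\<lambda>x::real. exp (K * x / 2) * e / (sqrt x * (s * sqrt (x + 1) + 1))) at_top at_top"
      using K s(1) by real_asymp
    then show ?thesis by (simp add: g_def e_def)
  qed
  then have "filterlim (\<lambda>t. g (u t)) at_top sequentially"
    by (rule filterlim_compose[OF _ u_lim])
  then show ?thesis
  proof (rule filterlim_at_top_mono)
    have "\<forall>\<^sub>F t in sequentially. C' < ln (v t) / u t"
      by (rule order_tendstoD(1)[OF C_lim C'(2)])
    then show "\<forall>\<^sub>F t in sequentially. g (u t) \<le> w t * normal_tail (s * a t)"
    proof eventually_elim
      case (elim t)
      have "exp (C' * u t) \<le> v t"
        using elim u_pos[of t] v_pos[of t] by (simp add: pos_less_divide_eq ln_ge_iff[symmetric] less_imp_le)
      then have "sqrt (exp (C' * u t) / u t) \<le> w t"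
        using u_pos[of t] by (simp add: w_eq divide_right_mono)
      moreover have "sqrt (exp (C' * u t) / u t) = exp (C' * u t / 2) / sqrt (u t)"
      proof -
        have "sqrt (exp (C' * u t)) = exp (C' * u t / 2)"
          by (rule real_sqrt_unique) (simp_all add: power2_eq_square flip: exp_add)
        then show ?thesis by (simp add: real_sqrt_divide)
      qed
      ultimately have 1: "exp (C' * u t / 2) / sqrt (u t) \<le> w t" by simp
      have 2: "std_normal_density (s * a t) / (s * a t + 1) \<le> normal_tail (s * a t)"
        using s a_pos[of t] by (intro normal_tail_ge) simp
      have "g (u t) = exp (C' * u t / 2) / sqrt (u t) * (std_normal_density (s * a t) / (s * a t + 1))"
      proof -
        have "exp (K * u t / 2) * exp (- s\<^sup>2 / 2) = exp (C' * u t / 2) * exp (- (s * a t)\<^sup>2 / 2)"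
          unfolding exp_add[symmetric] using u_pos[of t]
          by (simp add: K_def power_mult_distrib field_simps)
        then show ?thesis
          by (simp add: g_def std_normal_density_def)
      qed
      also have "\<dots> \<le> w t * normal_tail (s * a t)"
        by (rule mult_mono[OF 1 2]) (use w_pos[of t] s a_pos[of t] in auto)
      finally show ?case .
    qed
  qed
qed

lemma scaled_risk_tendsto_iff:
  assumes c: "\<And>t. c t > 0"
  shows "(\<lambda>t. scaled_risk (\<gamma> t) (c t)) \<longlonglongrightarrow> D \<longleftrightarrow>
    (\<lambda>t. c t / a t) \<longlonglongrightarrow> sqrt C \<and> (\<lambda>t. w t * normal_tail (c t)) \<longlonglongrightarrow> 0"
proof (intro iffI)
  assume lim: "(\<lambda>t. scaled_risk (\<gamma> t) (c t)) \<longlonglongrightarrow> D"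
  have type1: "w t * normal_tail (c t) > 0" for t
    using w_pos normal_tail_pos by simp
  have type2: "1 - 2 * normal_tail (c t / a t) > 0" for t
    using normal_tail_less_half[of "c t / a t"] c[of t] a_pos[of t] by simp
  have conv: "(\<lambda>t. c t / a t) \<longlonglongrightarrow> sqrt C"
  proof (rule order_tendstoI)
    fix l assume l: "l < sqrt C"
    \<comment> \<open>The maximum keeps \<open>s\<close> positive when \<open>l\<close> is not.\<close>
    define s where "s = max l (sqrt C / 2)"
    have s: "0 < s" "s < sqrt C" using l C_pos by (auto simp: s_def less_max_iff_disj)
    have "\<forall>\<^sub>F t in sequentially. w t * normal_tail (s * a t) > D + 1"
      using type1_diverges[OF s] by (simp add: filterlim_at_top_dense)
    moreover have "\<forall>\<^sub>F t in sequentially. scaled_risk (\<gamma> t) (c t) < D + 1"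
      by (rule order_tendstoD(2)[OF lim]) simp
    ultimately show "\<forall>\<^sub>F t in sequentially. l < c t / a t"
    proof eventually_elim
      case (elim t)
      have "w t * normal_tail (c t) < w t * normal_tail (s * a t)"
        using elim type1[of t] type2[of t] unfolding scaled_risk_eq by linarith
      then have "normal_tail (c t) < normal_tail (s * a t)"
        by (rule mult_left_less_imp_less) (use w_pos[of t] in simp)
      then have "s * a t < c t"
        using normal_tail_antimono[of "c t" "s * a t"] by linarith
      then have "s < c t / a t"
        using a_pos[of t] by (simp add: pos_less_divide_eq)
      then show ?case by (simp add: s_def)
    qed
  next
    fix l assume l: "sqrt C < l"
    have "\<forall>\<^sub>F t in sequentially. scaled_risk (\<gamma> t) (c t) < 1 - 2 * normal_tail l"
      using normal_tail_less[OF l] by (intro order_tendstoD(2)[OF lim]) simp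
    then show "\<forall>\<^sub>F t in sequentially. c t / a t < l"
    proof eventually_elim
      case (elim t)
      then have "normal_tail l < normal_tail (c t / a t)"
        using type1[of t] unfolding scaled_risk_eq by linarith
      then show ?case
        using normal_tail_antimono[of l "c t / a t"] by linarith
    qed
  qed
  moreover have "(\<lambda>t. w t * normal_tail (c t)) \<longlonglongrightarrow> 0"
    using tendsto_mult_left[OF tendsto_diff[OF lim detection_tendsto[OF conv]], of "1 / 2"]
    unfolding scaled_risk_eq by simp
  ultimately show "(\<lambda>t. c t / a t) \<longlonglongrightarrow> sqrt C \<and> (\<lambda>t. w t * normal_tail (c t)) \<longlonglongrightarrow> 0" ..
qed (use scaled_risk_tendsto in blast)

lemma ABOS_iff:
  assumes "\<And>t. c t > 0"
  shows "ABOS \<gamma> m (\<lambda>t. threshold_rule (\<gamma> t) (c t)) \<longleftrightarrow>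
    (\<lambda>t. c t / a t) \<longlonglongrightarrow> sqrt C \<and> (\<lambda>t. w t * normal_tail (c t)) \<longlonglongrightarrow> 0"
  by (simp only: ABOS_iff_scaled_risk[OF assms] scaled_risk_tendsto_iff[OF assms])

lemma threshold_at_top:
  assumes "(\<lambda>t. c t / a t) \<longlonglongrightarrow> sqrt C"
  shows "filterlim c at_top sequentially"
proof -
  have "filterlim (\<lambda>t. c t / a t * a t) at_top sequentially"
    by (rule filterlim_tendsto_pos_mult_at_top[OF assms _ a_lim]) (use C_pos in simp)
  moreover have "c t / a t * a t = c t" for t
    using a_pos[of t] by simp
  ultimately show ?thesis by simp
qed

lemma tail_ratio_tendsto_0:
  assumes "(\<lambda>t. c t / a t) \<longlonglongrightarrow> sqrt C"
  shows "(\<lambda>t. tail_ratio (\<gamma> t) (c t)) \<longlonglongrightarrow> 0"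
proof -
  have "(\<lambda>t. normal_tail (c t)) \<longlonglongrightarrow> 0"
    by (rule filterlim_compose[OF normal_tail_at_top threshold_at_top[OF assms]])
  from tendsto_divide[OF this isCont_tendsto_compose[OF isCont_normal_tail assms]]
  show ?thesis
    using normal_tail_pos[of "sqrt C"] by (simp add: tail_ratio_def)
qed

text \<open>
  Two threshold sequences with asymptotically equal tail ratios have asymptotically equal squares,
  and optimality of one implies optimality of the other.
\<close>

lemma transfer_threshold:
  assumes pos: "\<And>t. c t > 0" "\<And>t. c' t > 0"
    and c: "(\<lambda>t. c t / a t) \<longlonglongrightarrow> sqrt C" "(\<lambda>t. w t * normal_tail (c t)) \<longlonglongrightarrow> 0"
    and ratio: "(\<lambda>t. tail_ratio (\<gamma> t) (c t) / tail_ratio (\<gamma> t) (c' t)) \<longlonglongrightarrow> 1"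
  shows "(\<lambda>t. (c t)\<^sup>2 - (c' t)\<^sup>2) \<longlonglongrightarrow> 0"
    and "(\<lambda>t. c' t / a t) \<longlonglongrightarrow> sqrt C" and "(\<lambda>t. w t * normal_tail (c' t)) \<longlonglongrightarrow> 0"
proof -
  have "(\<lambda>t. ln (tail_ratio (\<gamma> t) (c t) / tail_ratio (\<gamma> t) (c' t))) \<longlonglongrightarrow> 0"
    using tendsto_ln[OF ratio] by simp
  then have up: "(\<lambda>t. 4 * \<bar>ln (tail_ratio (\<gamma> t) (c t) / tail_ratio (\<gamma> t) (c' t))\<bar>) \<longlonglongrightarrow> 0"
    using tendsto_mult_left[OF tendsto_rabs, of _ 0 sequentially 4] by fastforce
  have c_top: "filterlim c at_top sequentially" by (rule threshold_at_top[OF c(1)])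
  have "(\<lambda>t. 1 / 2 - 1 / (2 * (a t)\<^sup>2) - 1 / (a t * c t)) \<longlonglongrightarrow> 1 / 2 - 0 - 0"
  proof (intro tendsto_diff tendsto_const)
    show "(\<lambda>t. 1 / (2 * (a t)\<^sup>2)) \<longlonglongrightarrow> 0"
      by (rule filterlim_compose[OF _ a_lim]) real_asymp
    show "(\<lambda>t. 1 / (a t * c t)) \<longlonglongrightarrow> 0"
      by (rule tendsto_divide_0[OF tendsto_const filterlim_at_top_imp_at_infinity])
         (rule filterlim_at_top_mult_at_top[OF a_lim c_top])
  qed
  \<comment> \<open>Any positive bound below the limit 1/2 would do; it gives the factor 4.\<close>
  then have "\<forall>\<^sub>F t in sequentially. 1 / 4 < 1 / 2 - 1 / (2 * (a t)\<^sup>2) - 1 / (a t * c t)"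
    by (rule order_tendstoD) simp
  then have "\<forall>\<^sub>F t in sequentially. norm ((c t)\<^sup>2 - (c' t)\<^sup>2)
      \<le> 4 * \<bar>ln (tail_ratio (\<gamma> t) (c t) / tail_ratio (\<gamma> t) (c' t))\<bar>"
  proof eventually_elim
    case (elim t)
    have "\<bar>(c t)\<^sup>2 - (c' t)\<^sup>2\<bar> * (1 / 4)
        \<le> \<bar>(c t)\<^sup>2 - (c' t)\<^sup>2\<bar> * (1 / 2 - 1 / (2 * (a t)\<^sup>2) - 1 / (a t * c t))"
      using elim by (intro mult_left_mono) auto
    also have "\<dots> \<le> \<bar>ln (tail_ratio (\<gamma> t) (c t) / tail_ratio (\<gamma> t) (c' t))\<bar>"
      by (rule tail_ratio_gap[OF valid pos])
    finally show ?case by simp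
  qed
  from Lim_null_comparison[OF this up] show diff: "(\<lambda>t. (c t)\<^sup>2 - (c' t)\<^sup>2) \<longlonglongrightarrow> 0" .
  have "(\<lambda>t. ((c t)\<^sup>2 - (c' t)\<^sup>2) * (1 / (a t)\<^sup>2)) \<longlonglongrightarrow> 0 * 0"
    by (intro tendsto_mult diff, rule filterlim_compose[OF _ a_lim]) real_asymp
  \<comment> \<open>The difference of the squares vanishes even without division by \<open>a\<^sup>2\<close>.\<close>
  from tendsto_diff[OF tendsto_power[OF c(1), of 2] this]
  have "(\<lambda>t. (c' t / a t)\<^sup>2) \<longlonglongrightarrow> C"
    using C_pos by (simp add: power_divide diff_divide_distrib)
  then have "(\<lambda>t. sqrt ((c' t / a t)\<^sup>2)) \<longlonglongrightarrow> sqrt C"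
    by (rule tendsto_real_sqrt)
  then show c': "(\<lambda>t. c' t / a t) \<longlonglongrightarrow> sqrt C"
    using pos(2) a_pos by (simp add: abs_of_pos)
  \<comment> \<open>By definition, \<open>Q(c)\<close> is the product of the tail ratio of \<open>c\<close> and \<open>Q(c / a)\<close>.\<close>
  have tails: "(\<lambda>t. normal_tail (c' t / a t) / normal_tail (c t / a t)) \<longlonglongrightarrow> 1"
    using tendsto_divide[OF isCont_tendsto_compose[OF isCont_normal_tail c'] isCont_tendsto_compose[OF isCont_normal_tail c(1)]]
      normal_tail_pos[of "sqrt C"] by simp
  have "(\<lambda>t. w t * normal_tail (c t) * (normal_tail (c' t / a t) / normal_tail (c t / a t))
      / (tail_ratio (\<gamma> t) (c t) / tail_ratio (\<gamma> t) (c' t))) \<longlonglongrightarrow> 0 * 1 / 1"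
    by (intro tendsto_divide tendsto_mult c(2) tails ratio) simp
  moreover have "w t * normal_tail (c t) * (normal_tail (c' t / a t) / normal_tail (c t / a t))
      / (tail_ratio (\<gamma> t) (c t) / tail_ratio (\<gamma> t) (c' t)) = w t * normal_tail (c' t)" for t
    using normal_tail_pos[of "c t"] normal_tail_pos[of "c' t"] normal_tail_pos[of "c t / a t"] normal_tail_pos[of "c' t / a t"]
    by (simp add: tail_ratio_def field_simps)
  ultimately show "(\<lambda>t. w t * normal_tail (c' t)) \<longlonglongrightarrow> 0" by simp
qed

end

section \<open>Comparison of the two thresholds\<close>

theorem theorem4p2:
  fixes \<gamma> :: "nat \<Rightarrow> params" and m :: "nat \<Rightarrow> nat"
    and \<alpha> c_GW c_B :: "nat \<Rightarrow> real" and C :: real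
  assumes valid: "\<And>t. valid_params (\<gamma> t)"
    and m_pos: "\<And>t. m t \<ge> 1"
    and p_lim: "(\<lambda>t. p (\<gamma> t)) \<longlonglongrightarrow> 0"
    and u_lim: "filterlim (\<lambda>t. par_u (\<gamma> t)) at_top sequentially"
    and v_lim: "filterlim (\<lambda>t. par_v (\<gamma> t)) at_top sequentially"
    and C_pos: "C > 0"
    and C_lim: "(\<lambda>t. ln (par_v (\<gamma> t)) / par_u (\<gamma> t)) \<longlonglongrightarrow> C"
    and \<alpha>_range: "\<And>t. 0 < \<alpha> t \<and> \<alpha> t < 1 - p (\<gamma> t)"
    and c_GW: "\<And>t. solves_GW (\<gamma> t) (\<alpha> t) (c_GW t)"
    and c_B: "\<And>t. solves_B (\<gamma> t) (\<alpha> t) (c_B t)"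
  shows "(ABOS \<gamma> m (\<lambda>t. threshold_rule (\<gamma> t) (c_GW t)) \<longleftrightarrow>
          ABOS \<gamma> m (\<lambda>t. threshold_rule (\<gamma> t) (c_B t)))
       \<and> (ABOS \<gamma> m (\<lambda>t. threshold_rule (\<gamma> t) (c_GW t)) \<longrightarrow>
          (\<lambda>t. (c_GW t)\<^sup>2 - (c_B t)\<^sup>2) \<longlonglongrightarrow> 0)"
proof -
  interpret sparse_sequence \<gamma> m C
    by unfold_locales fact+
  let ?rGW = "\<lambda>t. tail_ratio (\<gamma> t) (c_GW t)" and ?rB = "\<lambda>t. tail_ratio (\<gamma> t) (c_B t)"
  have \<alpha>: "0 < \<alpha> t" "\<alpha> t < 1 - p (\<gamma> t)" for t
    using \<alpha>_range[of t] by auto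
  have pos_GW: "0 < c_GW t" for t by (rule solves_GW_pos[OF valid \<alpha> c_GW])
  have pos_B: "0 < c_B t" for t by (rule solves_B_pos[OF valid \<alpha> c_B])
  note ratio_eq = tail_ratio_GW_B[OF valid \<alpha> c_GW c_B]
  have ratio: "(\<lambda>t. ?rGW t / ?rB t) \<longlonglongrightarrow> 1" if "?rGW \<longlonglongrightarrow> 0"
  proof -
    have "(\<lambda>t. (1 - p (\<gamma> t)) * (1 - ?rGW t)) \<longlonglongrightarrow> (1 - 0) * (1 - 0)"
      by (intro tendsto_intros p_lim that)
    then show ?thesis by (simp add: ratio_eq)
  qed
  have rGW_le: "?rGW t \<le> ?rB t" for t
  proof -
    have "?rGW t / ?rB t \<le> (1 - p (\<gamma> t)) * 1"
      unfolding ratio_eq using valid[of t] tail_ratio_pos[of "\<gamma> t" "c_GW t"]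
      by (intro mult_left_mono) (auto simp: valid_params_def)
    also have "\<dots> \<le> 1"
      using valid[of t] by (simp add: valid_params_def)
    finally have "?rGW t / ?rB t \<le> 1" .
    then show ?thesis
      using tail_ratio_pos[of "\<gamma> t" "c_B t"] by simp
  qed
  note GW_iff = ABOS_iff[of c_GW, OF pos_GW] and B_iff = ABOS_iff[of c_B, OF pos_B]
  show ?thesis
  proof (intro conjI iffI impI)
    assume "ABOS \<gamma> m (\<lambda>t. threshold_rule (\<gamma> t) (c_GW t))"
    then have c: "(\<lambda>t. c_GW t / a t) \<longlonglongrightarrow> sqrt C" "(\<lambda>t. w t * normal_tail (c_GW t)) \<longlonglongrightarrow> 0"
      unfolding GW_iff by auto
    note * = transfer_threshold[OF pos_GW pos_B c ratio[OF tail_ratio_tendsto_0[OF c(1)]]]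
    show "ABOS \<gamma> m (\<lambda>t. threshold_rule (\<gamma> t) (c_B t))"
      unfolding B_iff using *(2,3) by simp
    show "(\<lambda>t. (c_GW t)\<^sup>2 - (c_B t)\<^sup>2) \<longlonglongrightarrow> 0"
      by (rule *(1))
  next
    assume "ABOS \<gamma> m (\<lambda>t. threshold_rule (\<gamma> t) (c_B t))"
    then have c: "(\<lambda>t. c_B t / a t) \<longlonglongrightarrow> sqrt C" "(\<lambda>t. w t * normal_tail (c_B t)) \<longlonglongrightarrow> 0"
      unfolding B_iff by auto
    have "?rGW \<longlonglongrightarrow> 0"
      by (rule tendsto_sandwich[OF _ _ tendsto_const tail_ratio_tendsto_0[OF c(1)]])
         (use rGW_le tail_ratio_pos in \<open>auto simp: less_imp_le\<close>)
    from tendsto_inverse[OF ratio[OF this]] have "(\<lambda>t. ?rB t / ?rGW t) \<longlonglongrightarrow> 1"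
      by simp
    from transfer_threshold(2,3)[OF pos_B pos_GW c this]
    show "ABOS \<gamma> m (\<lambda>t. threshold_rule (\<gamma> t) (c_GW t))"
      unfolding GW_iff by simp
  qed
qed

end
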